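(* There are an absolute constant $C>0$ and a polynomial-time algorithm that, given positive integers $f,k$ and an $n$-node graph $G=(V,E)$ with edge lengths $w:E\to\mathbb{R}_{\ge 0}$, outputs an $f$-edge fault tolerant $(2k-1)$-spanner $H$ of $G$ with $$|E(H)| \le \begin{cases} C\left(k^{5/2} f^{1/2-1/(2k)} n^{1+1/k} + k^2 fn\right) & \text{if } k \text{ is odd},\\ C\left(k^{5/2} f^{1/2} n^{1+1/k} + k^2 fn\right) & \text{if } k \text{ is even}.\end{cases}$$
   Context: Graphs are finite, undirected and simple, with nonnegative edge lengths $w$. For a graph $X$, $d_X(u,v)$ is the shortest-path distance with respect to $w$ (equal to $+\infty$ if $u,v$ are disconnected). A subgraph $H=(V,E')$ of $G=(V,E)$ (with inherited lengths) is an $f$-edge fault tolerant ($f$-EFT) $t$-spanner of $G$ if $d_{H\setminus F}(u,v)\le t\cdot d_{G\setminus F}(u,v)$ for all $u,v\in V$ and all $F\subseteq E$ with $|F|\le f$, where $X\setminus F$ denotes $X$ with the edges in $F$ removed. *)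

theory Defs
  imports
    Complex_Main
    "HOL-Library.Log_Nat"
    "HOL-Computational_Algebra.Polynomial"
    "Graph_Theory.Shortest_Path"
begin

section \<open>Graphs with edge lengths, and fault tolerant spanners\<close>

text \<open>Finite simple undirected graphs: edges are two-element sets of nodes.\<close>

definition simple_graph :: "'a set \<Rightarrow> 'a set set \<Rightarrow> bool" where
  "simple_graph V E \<longleftrightarrow> finite V \<and> (\<forall>e\<in>E. e \<subseteq> V \<and> card e = 2)"

text \<open>
  Graph_Theory only has directed graphs. An undirected graph is turned into one by replacing every
  edge with its two orientations; both orientations inherit the length of the edge, so walks and
  their lengths are those of the undirected graph.
\<close>

definition orient :: "'a set \<Rightarrow> 'a set set \<Rightarrow> ('a, 'a \<times> 'a) pre_digraph" where
  "orient V E = \<lparr>verts = V, arcs = {(u, v). {u, v} \<in> E}, tail = fst, head = snd\<rparr>"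

lemma wf_digraph_orient:
  assumes "simple_graph V E"
  shows "wf_digraph (orient V E)"
  using assms by unfold_locales (auto simp: simple_graph_def orient_def)

text \<open>The library's \<open>\<mu>\<close> is the infimum of the lengths of all walks, hence \<open>\<infinity>\<close> if there is none.\<close>

definition gdist :: "'a set \<Rightarrow> 'a set set \<Rightarrow> ('a set \<Rightarrow> real) \<Rightarrow> 'a \<Rightarrow> 'a \<Rightarrow> ereal" where
  "gdist V E w u v = wf_digraph.\<mu> (orient V E) (\<lambda>(a, b). w {a, b}) u v"

definition eft_spanner ::
  "nat \<Rightarrow> real \<Rightarrow> 'a set \<Rightarrow> 'a set set \<Rightarrow> ('a set \<Rightarrow> real) \<Rightarrow> 'a set set \<Rightarrow> bool" where
  "eft_spanner f t V E w H \<longleftrightarrow>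
     H \<subseteq> E \<and>
     (\<forall>F. F \<subseteq> E \<and> card F \<le> f \<longrightarrow>
        (\<forall>u\<in>V. \<forall>v\<in>V. gdist V (H - F) w u v \<le> ereal t * gdist V (E - F) w u v))"


section \<open>Algorithms\<close>

text \<open>
  Algorithms are programs of a small imperative language on a random access machine whose memory
  consists of named arrays (of any finite dimension; a scalar variable is an array accessed with
  the empty index list), one family holding natural numbers and one holding real numbers. Indices
  are computed, so addressing is indirect. Every assignment and every test costs one step
  (the expressions in it are part of the program text, hence of bounded size).

  The unit cost is a realistic measure because the only arithmetic operations are addition and
  (on naturals: truncated) subtraction. In \<open>t\<close> steps the bit length of a number grows by \<open>O(t)\<close>
  only (for rationals, relative to a common denominator of the inputs), so a polynomial number
  of steps is polynomial time on a Turing machine whenever the edge lengths are rational.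
  Multiplication, rounding of reals and non-integer constants are left out since, at unit cost,
  they would make the model unreasonably powerful.
\<close>

datatype nexp =
    NConst nat
  | NVar string "nexp list"
  | NAdd nexp nexp
  | NSub nexp nexp

datatype rexp =
    RConst int
  | RVar string "nexp list"
  | RAdd rexp rexp
  | RSub rexp rexp

datatype bexp =
    NLess nexp nexp
  | RLess rexp rexp
  | BNot bexp
  | BAnd bexp bexp

datatype com =
    Skip
  | NAssign string "nexp list" nexp
  | RAssign string "nexp list" rexp
  | Seq com com
  | Cond bexp com com
  | While bexp com

type_synonym nstore = "string \<Rightarrow> nat list \<Rightarrow> nat"
type_synonym rstore = "string \<Rightarrow> nat list \<Rightarrow> real"
type_synonym state = "nstore \<times> rstore"

definition store :: "(string \<Rightarrow> nat list \<Rightarrow> 'v) \<Rightarrow> string \<Rightarrow> nat list \<Rightarrow> 'v \<Rightarrow> string \<Rightarrow> nat list \<Rightarrow> 'v" where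
  "store m x is a = m(x := (m x)(is := a))"

fun neval :: "nstore \<Rightarrow> nexp \<Rightarrow> nat" where
  "neval m (NConst c) = c"
| "neval m (NVar x is) = m x (map (neval m) is)"
| "neval m (NAdd a b) = neval m a + neval m b"
| "neval m (NSub a b) = neval m a - neval m b"

fun reval :: "state \<Rightarrow> rexp \<Rightarrow> real" where
  "reval s (RConst c) = of_int c"
| "reval s (RVar x is) = snd s x (map (neval (fst s)) is)"
| "reval s (RAdd a b) = reval s a + reval s b"
| "reval s (RSub a b) = reval s a - reval s b"

fun beval :: "state \<Rightarrow> bexp \<Rightarrow> bool" where
  "beval s (NLess a b) \<longleftrightarrow> neval (fst s) a < neval (fst s) b"
| "beval s (RLess a b) \<longleftrightarrow> reval s a < reval s b"
| "beval s (BNot b) \<longleftrightarrow> \<not> beval s b"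
| "beval s (BAnd b c) \<longleftrightarrow> beval s b \<and> beval s c"

text \<open>\<open>exec c s t s'\<close>: started in \<open>s\<close>, program \<open>c\<close> halts after \<open>t\<close> steps in state \<open>s'\<close>.\<close>

inductive exec :: "com \<Rightarrow> state \<Rightarrow> nat \<Rightarrow> state \<Rightarrow> bool" where
  Skip: "exec Skip s 1 s"
| NAssign: "exec (NAssign x is a) (m, r) 1 (store m x (map (neval m) is) (neval m a), r)"
| RAssign: "exec (RAssign x is a) (m, r) 1 (m, store r x (map (neval m) is) (reval (m, r) a))"
| Seq: "exec c1 s t1 s1 \<Longrightarrow> exec c2 s1 t2 s2 \<Longrightarrow> exec (Seq c1 c2) s (t1 + t2) s2"
| CondTrue: "beval s b \<Longrightarrow> exec c1 s t s' \<Longrightarrow> exec (Cond b c1 c2) s (1 + t) s'"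
| CondFalse: "\<not> beval s b \<Longrightarrow> exec c2 s t s' \<Longrightarrow> exec (Cond b c1 c2) s (1 + t) s'"
| WhileFalse: "\<not> beval s b \<Longrightarrow> exec (While b c) s 1 s"
| WhileTrue: "beval s b \<Longrightarrow> exec c s t1 s1 \<Longrightarrow> exec (While b c) s1 t2 s2 \<Longrightarrow>
    exec (While b c) s (1 + t1 + t2) s2"

inductive_cases SkipE: "exec Skip s t s'"
inductive_cases NAssignE: "exec (NAssign x is a) s t s'"
inductive_cases RAssignE: "exec (RAssign x is a) s t s'"
inductive_cases SeqE: "exec (Seq c1 c2) s t s'"
inductive_cases CondE: "exec (Cond b c1 c2) s t s'"
inductive_cases WhileE: "exec (While b c) s t s'"

lemma exec_deterministic:
  "exec c s t s' \<Longrightarrow> exec c s t' s'' \<Longrightarrow> t = t' \<and> s' = s''"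
proof (induction arbitrary: t' s'' rule: exec.induct)
  case (Skip s)
  then show ?case by (rule SkipE) simp
next
  case (NAssign x ix a m r)
  then show ?case by (rule NAssignE) simp
next
  case (RAssign x ix a m r)
  then show ?case by (rule RAssignE) simp
next
  case (Seq c1 s t1 s1 c2 t2 s2)
  from Seq.prems obtain u1 u2 r where "t' = u1 + u2" "exec c1 s u1 r" "exec c2 r u2 s''"
    by (rule SeqE)
  with Seq.IH show ?case by blast
next
  case (CondTrue s b c1 t s' c2)
  from CondTrue.prems obtain u where "t' = 1 + u" "exec c1 s u s''"
    by (rule CondE) (use CondTrue.hyps(1) in simp_all)
  with CondTrue.IH show ?case by blast
next
  case (CondFalse s b c2 t s' c1)
  from CondFalse.prems obtain u where "t' = 1 + u" "exec c2 s u s''"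
    by (rule CondE) (use CondFalse.hyps(1) in simp_all)
  with CondFalse.IH show ?case by blast
next
  case (WhileFalse s b c)
  from WhileFalse.prems show ?case by (rule WhileE) (use WhileFalse.hyps in simp_all)
next
  case (WhileTrue s b c t1 s1 t2 s2)
  from WhileTrue.prems obtain u1 u2 r
    where "t' = 1 + u1 + u2" "exec c s u1 r" "exec (While b c) r u2 s''"
    by (rule WhileE) (use WhileTrue.hyps(1) in simp_all)
  with WhileTrue.IH show ?case by blast
qed


section \<open>Encoding of inputs and outputs\<close>

text \<open>
  The nodes of an \<open>n\<close>-node graph are numbered \<open>0, \<dots>, n - 1\<close>. The input consists of the numbers
  \<open>f\<close>, \<open>k\<close>, \<open>n\<close>, the adjacency matrix and the matrix of edge lengths; all other memory
  cells are initially 0. The output graph is read off the strict upper triangle of an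
  adjacency matrix.
\<close>

definition input_state :: "nat \<Rightarrow> nat \<Rightarrow> nat \<Rightarrow> nat set set \<Rightarrow> (nat set \<Rightarrow> real) \<Rightarrow> state" where
  "input_state f k n E w =
     (\<lambda>x is.
        if x = ''f'' \<and> is = [] then f
        else if x = ''k'' \<and> is = [] then k
        else if x = ''n'' \<and> is = [] then n
        else if x = ''adj'' \<and> (\<exists>i j. is = [i, j] \<and> {i, j} \<in> E) then 1
        else 0,
      \<lambda>x is. if x = ''w'' \<and> (\<exists>i j. is = [i, j] \<and> {i, j} \<in> E) then w (set is) else 0)"

definition output_edges :: "nat \<Rightarrow> state \<Rightarrow> nat set set" where
  "output_edges n s = {{i, j} | i j. i < j \<and> j < n \<and> fst s ''out'' [i, j] \<noteq> 0}"

text \<open>\<open>f\<close> and \<open>k\<close> are measured in binary; each real edge length counts as one unit.\<close>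

definition input_size :: "nat \<Rightarrow> nat \<Rightarrow> nat \<Rightarrow> nat set set \<Rightarrow> nat" where
  "input_size f k n E = floorlog 2 f + floorlog 2 k + n + card E"

end

theory Submission
  imports Defs
begin

text \<open>
  The program is the greedy algorithm: it considers the edges in the order of increasing length and
  packs edge-disjoint walks of at most \<open>2k - 1\<close> edges between the ends of the current edge \<open>e\<close>,
  skipping \<open>e\<close> if more than \<open>f\<close> of them are found. If \<open>e\<close> is added, the at most \<open>(2k - 1) f\<close> edges
  \<open>F e\<close> of the packing cut all short walks between its ends, so in every cycle of at most \<open>2k\<close>
  edges of the output the last edge \<open>e\<close> shares the cycle with an edge of \<open>F e\<close>.

  The size bound counts walks of \<open>k\<close> edges in which every second edge comes later than its
  neighbours and no two edges conflict, i.e. none lies in the set \<open>F\<close> of another. After discarding at most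
  half of the edges, every edge conflicts with \<open>O(kf)\<close> others. If \<open>p\<close> and \<open>q\<close> are two such walks
  with the same ends and the latest edge of both is \<open>e \<in> p\<close>, then \<open>F e\<close> meets \<open>q\<close>. Choosing \<open>q\<close> with
  the earliest possible latest edge leaves \<open>O(k\<^sup>2 f)\<close> candidates for a late edge of any other \<open>p\<close>, and
  the \<open>k div 2\<close> late edges determine the walk together with its ends. On the other hand, if the
  average degree is a large multiple of \<open>k\<^sup>2 f\<close>, there are \<open>n (\<Omega>(m / (k n)))\<^sup>k\<close> such walks.
\<close>


section \<open>Counting zigzag walks\<close>

text \<open>A smallest set of edges cutting all walks of at most \<open>2 * k - 1\<close> edges is
  hard to compute in general. A maximal edge-disjoint packing takes one search per walk and is a cut
  up to a factor \<open>2 * k - 1\<close>; this loss makes \<Delta> of order \<open>k f\<close>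
  instead of \<open>f\<close>.

  The zigzag order keeps the latest edge off the even positions. Without it all \<open>k\<close>
  edges would have to be guessed and \<open>f\<close> would enter with exponent 1.

  With \<open>q\<close> of order \<open>m / (k n)\<close> the two counts give
  \<open>q^k \<le> n (k^2 \<Delta>)^(k div 2)\<close>, hence
  \<open>q = O(n^(1/k) k^(3/2) f^x)\<close> with \<open>x = (k div 2) / k\<close>. So
  \<open>m = O(k n q)\<close> carries \<open>k^(5/2)\<close>, and the parity split is the value of
  \<open>x\<close>. If \<open>q\<close> is too small for the lower bound on the number of walks, the
  term \<open>k^2 f n\<close> takes over.

  Since \<open>f\<close> and \<open>k\<close> are given in binary, no loop may run \<open>f\<close>
  or \<open>k\<close> times: the lengths of walks and the rounds of a packing are capped at
  \<open>n * n\<close>.\<close>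

definition sym_arcs :: "'a set set \<Rightarrow> ('a \<times> 'a) set" where
  "sym_arcs E = {(u, v). {u, v} \<in> E}"

lemma sym_arcs_mono: "E \<subseteq> E' \<Longrightarrow> sym_arcs E \<subseteq> sym_arcs E'"
  by (auto simp: sym_arcs_def)

lemma relpow_sym_arcs_sym: "(u, v) \<in> sym_arcs E ^^ l \<Longrightarrow> (v, u) \<in> sym_arcs E ^^ l"
proof (induction l arbitrary: v)
  case (Suc l)
  then obtain x where "(u, x) \<in> sym_arcs E ^^ l" "(x, v) \<in> sym_arcs E" by auto
  then have "(x, u) \<in> sym_arcs E ^^ l" "(v, x) \<in> sym_arcs E"
    using Suc.IH by (auto simp: sym_arcs_def insert_commute)
  then show ?case by (rule relpow_Suc_I2[rotated])
qed simp

lemma relpow_trans: "(x, y) \<in> r ^^ a \<Longrightarrow> (y, z) \<in> r ^^ b \<Longrightarrow> (x, z) \<in> r ^^ (a + b)"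
  by (auto simp: relpow_add)

lemma relpow_segment:
  assumes "i \<le> j" "\<And>p. i \<le> p \<Longrightarrow> p < j \<Longrightarrow> (f p, f (Suc p)) \<in> r"
  shows "(f i, f j) \<in> r ^^ (j - i)"
  using assms
proof (induction "j - i" arbitrary: j)
  case 0
  then show ?case by simp
next
  case (Suc d)
  then obtain j' where j': "j = Suc j'" "i \<le> j'" by (cases j) auto
  have "(f i, f j') \<in> r ^^ (j' - i)" using Suc j' by auto
  moreover have "(f j', f j) \<in> r" using Suc.prems j' by auto
  ultimately show ?case using j' by (auto simp: Suc_diff_le)
qed

lemma card_UN_le_mult:
  assumes "finite I" "\<And>i. i \<in> I \<Longrightarrow> card (A i) \<le> c"
  shows "card (\<Union>i\<in>I. A i) \<le> card I * c"
proof -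
  have "card (\<Union>i\<in>I. A i) \<le> (\<Sum>i\<in>I. card (A i))" using assms(1) by (rule card_UN_le)
  also have "\<dots> \<le> card I * c" using sum_bounded_above[of I "\<lambda>i. card (A i)" c] assms by simp
  finally show ?thesis .
qed

lemma finite_has_min_key:
  fixes f :: "'a \<Rightarrow> 'b::linorder"
  assumes "finite S" "S \<noteq> {}"
  shows "\<exists>x\<in>S. \<forall>y\<in>S. f x \<le> f y"
  using arg_min_if_finite[OF assms, of f] by (metis linorder_not_less)

text \<open>\<open>pos\<close> is the order of insertion and \<open>R\<close> the conflict relation.
  \<open>R_refl\<close> makes a walk without conflicts free of repeated edges.
  \<open>blocked\<close> speaks of walks, not paths, because it is applied to a walk glued from
  pieces of two zigzag walks, which may revisit vertices.\<close>

locale conflict_graph =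
  fixes V :: "'a set" and E :: "'a set set" and pos :: "'a set \<Rightarrow> nat"
    and R :: "'a set \<Rightarrow> 'a set \<Rightarrow> bool" and \<Delta> k :: nat
  assumes graph: "simple_graph V E"
    and inj_pos: "inj_on pos E"
    and R_refl: "\<And>e. e \<in> E \<Longrightarrow> R e e"
    and R_sym: "\<And>e e'. R e e' \<Longrightarrow> R e' e"
    and R_deg: "\<And>e. e \<in> E \<Longrightarrow> card {e' \<in> E. R e e'} \<le> \<Delta>"
    and k_pos: "k \<ge> 1"
    and blocked: "\<And>u v l. {u, v} \<in> E \<Longrightarrow> l \<le> 2 * k - 1 \<Longrightarrow>
      (u, v) \<notin> sym_arcs {e \<in> E. pos e < pos {u, v} \<and> \<not> R {u, v} e} ^^ l"
begin

lemma finite_V: "finite V"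
  using graph by (simp add: simple_graph_def)

lemma finite_E: "finite E"
proof (rule finite_subset)
  show "E \<subseteq> Pow V" using graph by (auto simp: simple_graph_def)
qed (simp add: finite_V)

lemma finite_arcs: "finite (sym_arcs E)"
proof (rule finite_subset)
  show "sym_arcs E \<subseteq> V \<times> V" using graph by (auto simp: simple_graph_def sym_arcs_def)
qed (simp add: finite_V)

lemma arc_in_V: "{u, v} \<in> E \<Longrightarrow> u \<in> V \<and> v \<in> V"
  using graph by (auto simp: simple_graph_def)

abbreviation edge :: "'a list \<Rightarrow> nat \<Rightarrow> 'a set" where
  "edge p i \<equiv> {p ! i, p ! Suc i}"

definition zigzag :: "bool \<Rightarrow> 'a set \<Rightarrow> 'a set \<Rightarrow> bool" where
  "zigzag b e e' \<longleftrightarrow> (if b then pos e < pos e' else pos e' < pos e)"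

text \<open>Edges are numbered from 0, so the edges at odd positions are the late ones.\<close>

definition zpath :: "nat \<Rightarrow> 'a list \<Rightarrow> bool" where
  "zpath m p \<longleftrightarrow> length p = Suc m \<and> (\<forall>i<m. edge p i \<in> E) \<and>
     (\<forall>i. Suc i < m \<longrightarrow> zigzag (even i) (edge p i) (edge p (Suc i))) \<and>
     (\<forall>j<m. \<forall>i<j. \<not> R (edge p i) (edge p j))"

lemma zpath_length: "zpath m p \<Longrightarrow> length p = Suc m"
  by (simp add: zpath_def)

lemma zpath_edge: "zpath m p \<Longrightarrow> i < m \<Longrightarrow> edge p i \<in> E"
  by (simp add: zpath_def)

lemma zpath_avoid: "zpath m p \<Longrightarrow> i < m \<Longrightarrow> j < m \<Longrightarrow> i \<noteq> j \<Longrightarrow> \<not> R (edge p i) (edge p j)"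
  unfolding zpath_def using R_sym by (metis linorder_neq_iff)

lemma zpath_even_less_next:
  assumes "zpath m p" "even i" "Suc i < m"
  shows "pos (edge p i) < pos (edge p (Suc i))"
proof -
  have "zigzag (even i) (edge p i) (edge p (Suc i))" using assms unfolding zpath_def by blast
  then show ?thesis using assms(2) by (simp add: zigzag_def)
qed

lemma zpath_even_less_prev:
  assumes "zpath m p" "even (Suc i)" "Suc i < m"
  shows "pos (edge p (Suc i)) < pos (edge p i)"
proof -
  have "zigzag (even i) (edge p i) (edge p (Suc i))" using assms unfolding zpath_def by blast
  then show ?thesis using assms(2) by (simp add: zigzag_def)
qed

lemma card_arcs_le:
  assumes "N \<subseteq> E"
  shows "card (sym_arcs N) \<le> 2 * card N"
proof -
  have fin: "finite N" using assms finite_E by (rule finite_subset)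
  have eq: "sym_arcs N = (\<Union>x\<in>N. {(a, b). {a, b} = x})" by (auto simp: sym_arcs_def)
  have "card {(a, b). {a, b} = x} \<le> 2" if "x \<in> N" for x
  proof -
    from that assms have "card x = 2" using graph by (auto simp: simple_graph_def)
    then obtain c d where "x = {c, d}" by (meson card_2_iff)
    then have "{(a, b). {a, b} = x} = {(c, d), (d, c)}" by (auto simp: doubleton_eq_iff)
    then show ?thesis by (simp add: card_insert_le_m1)
  qed
  then have "card (\<Union>x\<in>N. {(a, b). {a, b} = x}) \<le> card N * 2"
    using fin by (intro card_UN_le_mult)
  then show ?thesis unfolding eq by simp
qed

text \<open>Otherwise the walk back along \<open>p\<close>, along \<open>q\<close> and back along \<open>p\<close>, between the vertices next to
  \<open>c\<close> where \<open>p\<close> and \<open>q\<close> are known to agree, would connect the ends of the edge \<open>c\<close> of \<open>p\<close>.\<close>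

lemma zpath_latest_conflict:
  assumes p: "zpath k p" and q: "zpath k q"
    and ends: "p ! 0 = q ! 0" "p ! k = q ! k"
    and agree: "\<And>i. i < k \<Longrightarrow> odd i \<Longrightarrow> i \<notin> U \<Longrightarrow> p ! i = q ! i \<and> p ! Suc i = q ! Suc i"
    and c: "c \<in> U" "c < k" "odd c"
    and max_p: "\<And>i. i \<in> U \<Longrightarrow> pos (edge p i) \<le> pos (edge p c)"
    and max_q: "\<And>i. i \<in> U \<Longrightarrow> pos (edge q i) < pos (edge p c)"
    and U: "U \<subseteq> {i. i < k \<and> odd i}"
  shows "\<exists>i<k. R (edge q i) (edge p c)"
proof (rule ccontr)
  assume contra: "\<not> ?thesis"
  let ?e = "edge p c"
  let ?A = "sym_arcs {x \<in> E. pos x < pos ?e \<and> \<not> R ?e x}"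
  \<comment> \<open>\<open>I\<close> and \<open>J\<close> consist of vertices where \<open>p\<close>
    and \<open>q\<close> agree: ends of the walks, or ends of late edges outside \<open>U\<close>.
    Between the nearest ones on both sides of \<open>c\<close> all late edges lie in
    \<open>U\<close>, where \<open>max_p\<close> and \<open>max_q\<close> control them.\<close>
  define I where "I = {x. x \<le> c \<and> (x = 0 \<or> odd (x - 1) \<and> x - 1 \<notin> U)}"
  define J where "J = {x. c < x \<and> x \<le> k \<and> (x = k \<or> odd x \<and> x \<notin> U)}"
  define i where "i = Max I"
  define j where "j = Min J"
  have finI: "finite I" unfolding I_def by simp
  have finJ: "finite J" unfolding J_def by simp
  have "0 \<in> I" unfolding I_def by simp
  then have iI: "i \<in> I" unfolding i_def using finI by (intro Max_in) auto
  have "k \<in> J" unfolding J_def using c by simp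
  then have jJ: "j \<in> J" unfolding j_def using finJ by (intro Min_in) auto
  have ic: "i \<le> c" and cj: "c < j" and jk: "j \<le> k" using iI jJ unfolding I_def J_def by auto
  have even_i: "even i" using iI unfolding I_def by (cases i) auto
  have odd_U: "x \<in> U" if "i \<le> x" "x < j" "odd x" for x
  proof (rule ccontr)
    assume xU: "x \<notin> U"
    then have "x \<noteq> c" using c by auto
    then consider "x < c" | "c < x" by linarith
    then show False
    proof cases
      case 1
      then have "Suc x \<in> I" unfolding I_def using xU that by auto
      then have "Suc x \<le> i" unfolding i_def using finI by simp
      then show False using that by simp
    next
      case 2
      then have "x \<in> J" unfolding J_def using xU that jk by auto
      then have "j \<le> x" unfolding j_def using finJ by simp
      then show False using that by simp
    qed
  qed
  \<comment> \<open>At the left end of the window the late neighbour is the right one, which is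
    present since \<open>i\<close> is even and \<open>c\<close> is odd; elsewhere it is the left
    one.\<close>
  have odd_nb: "\<exists>y. i \<le> y \<and> y < j \<and> odd y \<and> (y = Suc x \<or> x = Suc y)" if "i \<le> x" "x < j" "even x" for x
  proof (cases "x = i")
    case True
    then have "Suc x \<le> c" using ic even_i c by (cases "i = c") auto
    then show ?thesis using that cj by (intro exI[of _ "Suc x"]) auto
  next
    case False
    then have "0 < x" using \<open>i \<le> x\<close> by simp
    then obtain y where y: "x = Suc y" by (cases x) auto
    then show ?thesis using that False by (intro exI[of _ y]) auto
  qed
  have even_lt: "pos (edge r x) < pos ?e"
    if "zpath k r" "\<And>y. y \<in> U \<Longrightarrow> pos (edge r y) \<le> pos ?e" "i \<le> x" "x < j" "even x" for r x
  proof -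
    from odd_nb[OF that(3-5)] obtain y
      where y: "i \<le> y" "y < j" "odd y" "y = Suc x \<or> x = Suc y" by blast
    have "pos (edge r x) < pos (edge r y)"
      using y that jk zpath_even_less_next[OF that(1), of x] zpath_even_less_prev[OF that(1), of y]
      by auto
    moreover have "pos (edge r y) \<le> pos ?e" using that(2) odd_U y by blast
    ultimately show ?thesis by simp
  qed
  have q_arc: "(q ! x, q ! Suc x) \<in> ?A" if "i \<le> x" "x < j" for x
  proof -
    have "pos (edge q x) < pos ?e"
    proof (cases "even x")
      case True
      then show ?thesis using even_lt[OF q] that max_q by (meson less_imp_le)
    next
      case False
      then show ?thesis using odd_U that max_q by blast
    qed
    moreover have "edge q x \<in> E" using zpath_edge[OF q] that jk by simp
    moreover have "\<not> R ?e (edge q x)" using contra that jk R_sym by (meson less_le_trans)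
    ultimately show ?thesis by (simp add: sym_arcs_def)
  qed
  have p_arc: "(p ! x, p ! Suc x) \<in> ?A" if "i \<le> x" "x < j" "x \<noteq> c" for x
  proof -
    have E: "edge p x \<in> E" "?e \<in> E" using zpath_edge[OF p] that jk c by simp_all
    have nR: "\<not> R ?e (edge p x)" using zpath_avoid[OF p] that jk c by simp
    have "pos (edge p x) < pos ?e"
    proof (cases "even x")
      case True
      then show ?thesis using even_lt[OF p] that max_p by blast
    next
      case False
      then have "pos (edge p x) \<le> pos ?e" using odd_U that max_p by blast
      moreover have "edge p x \<noteq> ?e" using nR E R_refl by metis
      then have "pos (edge p x) \<noteq> pos ?e" using inj_pos E by (auto dest: inj_onD)
      ultimately show ?thesis by simp
    qed
    then show ?thesis using E nR by (simp add: sym_arcs_def)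
  qed
  have pi: "p ! i = q ! i"
  proof (cases i)
    case 0
    then show ?thesis using ends by simp
  next
    case (Suc y)
    then have "odd y" "y \<notin> U" "y < k" using iI c unfolding I_def by auto
    then show ?thesis using agree Suc by blast
  qed
  have pj: "p ! j = q ! j"
  proof (cases "j = k")
    case False
    then show ?thesis using agree jJ unfolding J_def by auto
  qed (use ends in simp)
  have w1: "(p ! i, p ! c) \<in> ?A ^^ (c - i)" using ic cj by (intro relpow_segment p_arc) auto
  have w2: "(q ! i, q ! j) \<in> ?A ^^ (j - i)" using ic cj by (intro relpow_segment q_arc) auto
  have w3: "(p ! Suc c, p ! j) \<in> ?A ^^ (j - Suc c)" using ic cj by (intro relpow_segment p_arc) auto
  have "(p ! c, p ! Suc c) \<in> ?A ^^ (c - i + (j - i) + (j - Suc c))"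
    using relpow_trans[OF relpow_trans[OF relpow_sym_arcs_sym[OF w1] w2[folded pi pj]]
        relpow_sym_arcs_sym[OF w3]] .
  \<comment> \<open>The two pieces of \<open>p\<close> have \<open>j - i - 1\<close> edges together
    and the piece of \<open>q\<close> has \<open>j - i\<close>. The sum
    \<open>2 * (j - i) - 1\<close> is what fixes the length bound in \<open>blocked\<close>.\<close>
  moreover have "c - i + (j - i) + (j - Suc c) \<le> 2 * k - 1" using ic cj jk by linarith
  moreover have "?e \<in> E" using zpath_edge[OF p] c by simp
  ultimately show False using blocked by blast
qed

section \<open>Upper bound: few zigzag walks share both ends\<close>

lemma card_conflicts_zpath:
  assumes "zpath m q"
  shows "card {x \<in> E. \<exists>i<m. R (edge q i) x} \<le> m * \<Delta>"
proof -
  have "{x \<in> E. \<exists>i<m. R (edge q i) x} = (\<Union>i\<in>{..<m}. {x \<in> E. R (edge q i) x})" by auto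
  also have "card \<dots> \<le> card {..<m} * \<Delta>"
    using zpath_edge[OF assms] R_deg by (intro card_UN_le_mult) auto
  finally show ?thesis by simp
qed

lemma card_odd_less:
  assumes "U \<subseteq> {i. i < k \<and> odd i}"
  shows "2 * card U \<le> k"
proof -
  have inj: "inj_on (\<lambda>i. i div 2) U"
  proof (rule inj_onI)
    fix x y assume "x \<in> U" "y \<in> U" and eq: "x div 2 = y div 2"
    then have "odd x" "odd y" using assms by auto
    then show "x = y" using eq by (metis odd_two_times_div_two_succ)
  qed
  have "(\<lambda>i. i div 2) ` U \<subseteq> {..<k div 2}" using assms by (auto elim!: oddE)
  then have "card U \<le> card {..<k div 2}"
    using card_inj_on_le[OF inj] by blast
  then show ?thesis by simp
qed

text \<open>Induction on the number of late positions \<open>U\<close> that are still free. The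
  branching factor \<open>k * k * \<Delta>\<close> is made of at most \<open>k / 2\<close>
  positions, at most \<open>k * \<Delta>\<close> edges in conflict with the chosen walk
  \<open>q\<close>, and 2 orientations; each choice fixes one more position.\<close>

lemma dispersion:
  assumes "finite P" "\<And>p. p \<in> P \<Longrightarrow> zpath k p"
    and "\<And>p q. p \<in> P \<Longrightarrow> q \<in> P \<Longrightarrow> p ! 0 = q ! 0 \<and> p ! k = q ! k"
    and "\<And>p q i. p \<in> P \<Longrightarrow> q \<in> P \<Longrightarrow> i < k \<Longrightarrow> odd i \<Longrightarrow> i \<notin> U \<Longrightarrow>
      p ! i = q ! i \<and> p ! Suc i = q ! Suc i"
    and "U \<subseteq> {i. i < k \<and> odd i}"
  shows "card P \<le> (k * k * \<Delta>) ^ card U"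
  using assms
proof (induction "card U" arbitrary: U P)
  case 0
  have "finite U" using 0(6) by (rule finite_subset) simp
  then have "U = {}" using 0(1) by simp
  have "p = q" if "p \<in> P" "q \<in> P" for p q
  proof (rule nth_equalityI)
    show "length p = length q" using 0(3) that zpath_length by metis
    fix x assume x: "x < length p"
    then have xk: "x \<le> k" using 0(3) that zpath_length by fastforce
    \<comment> \<open>With no free position left, every vertex is an end of the walk or an end of a
      fixed late edge.\<close>
    consider "x = 0" | "x = k" | "odd x" "x < k" | y where "x = Suc y" "odd y" "y < k"
      using xk by (cases x) (auto simp: le_less)
    then show "p ! x = q ! x"
      using 0(4)[OF that] 0(5)[OF that] \<open>U = {}\<close> by cases auto
  qed
  then have "card P \<le> Suc 0" using 0(2) by (subst card_le_Suc0_iff_eq) auto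
  then show ?case using \<open>U = {}\<close> by simp
next
  case (Suc d)
  let ?M = "k * k * \<Delta>"
  have finU: "finite U" using Suc.prems(5) by (rule finite_subset) simp
  have U_ne: "U \<noteq> {}" using Suc.hyps(2) by auto
  show ?case
  proof (cases "P = {}")
    case False
    define mx where "mx p = Max ((\<lambda>i. pos (edge p i)) ` U)" for p
    have mx_in: "mx p \<in> (\<lambda>i. pos (edge p i)) ` U" for p
      unfolding mx_def using finU U_ne by (intro Max_in) auto
    have mx_ge: "pos (edge p i) \<le> mx p" if "i \<in> U" for p i
      unfolding mx_def using finU that by (intro Max_ge) auto
    obtain q where q: "q \<in> P" "\<And>p. p \<in> P \<Longrightarrow> mx q \<le> mx p"
      using finite_has_min_key[OF Suc.prems(1) False, of mx] by blast
    define N where "N = {x \<in> E. \<exists>i<k. R (edge q i) x}"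
    have N: "N \<subseteq> E" "card N \<le> k * \<Delta>"
      unfolding N_def using card_conflicts_zpath Suc.prems(2) q(1) by auto
    have finA: "finite (sym_arcs N)"
      using finite_arcs sym_arcs_mono[OF N(1)] by (rule rev_finite_subset)
    have hit: "\<exists>i\<in>U. edge p i \<in> N" if p: "p \<in> P" for p
    proof -
      obtain c where c: "c \<in> U" "mx p = pos (edge p c)"
        using mx_in[of p] by (rule imageE)
      then have ck: "c < k" "odd c" using Suc.prems(5) by auto
      have pE: "edge p c \<in> E" using zpath_edge Suc.prems(2) p ck by blast
      have "\<exists>i<k. R (edge q i) (edge p c)"
      proof (cases "mx q < mx p")
        case True
        show ?thesis
        proof (rule zpath_latest_conflict[where U = U])
          show "pos (edge q i) < pos (edge p c)" if "i \<in> U" for i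
            using mx_ge[OF that, of q] True c by simp
          show "pos (edge p i) \<le> pos (edge p c)" if "i \<in> U" for i
            using mx_ge[OF that, of p] c by simp
        qed (use Suc.prems p q c ck in blast)+
      next
        case False
        \<comment> \<open>On a tie, injectivity of \<open>pos\<close> makes the two latest free
          edges equal, possibly at different positions, and the common edge conflicts with itself by
          \<open>R_refl\<close>.\<close>
        then have eq: "mx q = mx p" using q(2)[OF p] by simp
        obtain c' where c': "c' \<in> U" "mx q = pos (edge q c')"
          using mx_in[of q] by (rule imageE)
        then have ck': "c' < k" using Suc.prems(5) by auto
        have "edge q c' \<in> E" using zpath_edge Suc.prems(2) q ck' by blast
        then have "edge q c' = edge p c" using inj_pos pE eq c c' by (metis inj_onD)
        then show ?thesis using R_refl[OF pE] ck' by metis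
      qed
      then show ?thesis using c pE unfolding N_def by blast
    qed
    have sub: "P \<subseteq> (\<Union>(i, a, b)\<in>U \<times> sym_arcs N. {p \<in> P. p ! i = a \<and> p ! Suc i = b})"
    proof
      fix p assume p: "p \<in> P"
      then obtain i where "i \<in> U" "edge p i \<in> N" using hit by blast
      then show "p \<in> (\<Union>(i, a, b)\<in>U \<times> sym_arcs N. {p \<in> P. p ! i = a \<and> p ! Suc i = b})"
        using p by (intro UN_I[of "(i, p ! i, p ! Suc i)"]) (auto simp: sym_arcs_def)
    qed
    have each: "card (case x of (i, a, b) \<Rightarrow> {p \<in> P. p ! i = a \<and> p ! Suc i = b}) \<le> ?M ^ d"
      if "x \<in> U \<times> sym_arcs N" for x
    proof -
      obtain i a b where x: "x = (i, a, b)" by (cases x)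
      have i: "i \<in> U" using that x by simp
      have "card {p \<in> P. p ! i = a \<and> p ! Suc i = b} \<le> ?M ^ card (U - {i})"
      proof (rule Suc.hyps(1))
        show "d = card (U - {i})" using Suc.hyps(2) i finU by simp
        show "p ! x = q ! x \<and> p ! Suc x = q ! Suc x"
          if "p \<in> {p \<in> P. p ! i = a \<and> p ! Suc i = b}" "q \<in> {p \<in> P. p ! i = a \<and> p ! Suc i = b}"
            "x < k" "odd x" "x \<notin> U - {i}" for p q x
          using that Suc.prems(4)[of p q x] by (cases "x = i") auto
      qed (use Suc.prems in auto)
      moreover have "card (U - {i}) = d" using Suc.hyps(2) i finU by simp
      ultimately show ?thesis using x by simp
    qed
    have "2 * card U \<le> k" using card_odd_less Suc.prems(5) .
    moreover have "card (sym_arcs N) \<le> 2 * (k * \<Delta>)" using card_arcs_le[OF N(1)] N(2) by linarith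
    ultimately have "card U * card (sym_arcs N) \<le> card U * (2 * (k * \<Delta>))" by simp
    also have "\<dots> = (2 * card U) * (k * \<Delta>)" by simp
    also have "\<dots> \<le> k * (k * \<Delta>)" using \<open>2 * card U \<le> k\<close> by (rule mult_right_mono) simp
    finally have UA: "card U * card (sym_arcs N) \<le> ?M" by (simp add: mult.assoc)
    have "card P \<le> card (\<Union>(i, a, b)\<in>U \<times> sym_arcs N. {p \<in> P. p ! i = a \<and> p ! Suc i = b})"
      using sub Suc.prems(1) finU finA by (intro card_mono) (auto intro: finite_subset[of _ P])
    also have "\<dots> \<le> card (U \<times> sym_arcs N) * ?M ^ d"
      using finU finA each by (intro card_UN_le_mult) auto
    also have "\<dots> \<le> ?M * ?M ^ d"
      using UA by (intro mult_right_mono) (simp_all add: card_cartesian_product)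
    finally show ?thesis using Suc.hyps(2)[symmetric] by simp
  qed simp
qed

lemma zpath_in_V:
  assumes "zpath m p" "1 \<le> m"
  shows "set p \<subseteq> V"
proof
  fix x assume "x \<in> set p"
  then obtain i where i: "i < Suc m" "x = p ! i"
    using zpath_length[OF assms(1)] by (metis in_set_conv_nth)
  show "x \<in> V"
  proof (cases "i < m")
    case True
    then show ?thesis using arc_in_V zpath_edge[OF assms(1)] i by blast
  next
    case False
    then have "x = p ! Suc (m - 1)" "m - 1 < m" using i assms(2) by (auto simp: le_less_Suc_eq)
    then show ?thesis using arc_in_V zpath_edge[OF assms(1)] by blast
  qed
qed

text \<open>The walks are classified by their two ends; within a class all late positions are free
  and \<open>dispersion\<close> applies. The base of the power is at least 1, so its exponent may be
  raised to \<open>k div 2\<close>.\<close>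

lemma card_zpaths_le:
  assumes "\<Delta> \<ge> 1"
  shows "card {p. zpath k p} \<le> card V * card V * (k * k * \<Delta>) ^ (k div 2)"
    and "finite {p. zpath k p}"
proof -
  let ?P = "\<lambda>s t. {p. zpath k p \<and> p ! 0 = s \<and> p ! k = t}"
  note in_V = zpath_in_V[OF _ k_pos]
  have "{p. zpath k p} \<subseteq> {p. set p \<subseteq> V \<and> length p = Suc k}"
    using in_V zpath_length by blast
  then show fin: "finite {p. zpath k p}"
    by (rule finite_subset) (rule finite_lists_length_eq[OF finite_V])
  have "p ! 0 \<in> V \<and> p ! k \<in> V" if "zpath k p" for p
    using in_V[OF that] zpath_length[OF that] by (auto simp: subset_iff)
  then have "{p. zpath k p} \<subseteq> (\<Union>x\<in>V \<times> V. ?P (fst x) (snd x))"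
    by force
  then have "card {p. zpath k p} \<le> card (\<Union>x\<in>V \<times> V. ?P (fst x) (snd x))"
    using fin finite_V by (intro card_mono) (auto intro: rev_finite_subset[OF fin])
  also have "\<dots> \<le> card (V \<times> V) * (k * k * \<Delta>) ^ (k div 2)"
  proof (rule card_UN_le_mult)
    fix x
    let ?U = "{i. i < k \<and> odd i}"
    have "card (?P (fst x) (snd x)) \<le> (k * k * \<Delta>) ^ card ?U"
      by (rule dispersion) (auto intro: rev_finite_subset[OF fin])
    also have "\<dots> \<le> (k * k * \<Delta>) ^ (k div 2)"
      using card_odd_less[of ?U] k_pos assms by (intro power_increasing) auto
    finally show "card (?P (fst x) (snd x)) \<le> (k * k * \<Delta>) ^ (k div 2)" .
  qed (simp add: finite_V)
  finally show "card {p. zpath k p} \<le> card V * card V * (k * k * \<Delta>) ^ (k div 2)"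
    by (simp add: card_cartesian_product)
qed

section \<open>Arcs from which zigzag walks continue\<close>

text \<open>Each of the \<open>j\<close> levels loses at most \<open>D\<close> arcs per node, which makes \<open>D\<close> of the order of
  \<open>card E / (k * card V)\<close> affordable.\<close>

primrec good :: "nat \<Rightarrow> nat \<Rightarrow> bool \<Rightarrow> ('a \<times> 'a) set" where
  "good D 0 b = sym_arcs E"
| "good D (Suc j) b = {(u, v). {u, v} \<in> E \<and>
     D \<le> card {w. (v, w) \<in> good D j (\<not> b) \<and> zigzag b {u, v} {v, w}}}"

lemma good_subset: "good D j b \<subseteq> sym_arcs E"
  by (cases j) (auto simp: sym_arcs_def)

text \<open>Among the arcs into \<open>v\<close> that become bad although their reversals are still
  good, take the extreme one \<open>(x, v)\<close> in the direction of \<open>b\<close>. The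
  reversals of all the others are valid continuations of it, and a bad arc has fewer than
  \<open>D\<close> of those. So at most \<open>D\<close> arcs per node are newly lost.\<close>

lemma card_not_good_step:
  "card (sym_arcs E - good D (Suc j) b) \<le> card V * D + card (sym_arcs E - good D j (\<not> b))"
proof -
  let ?G = "good D (Suc j) b" and ?G' = "good D j (\<not> b)"
  define Y where "Y v = {u. (u, v) \<in> sym_arcs E - ?G \<and> (v, u) \<in> ?G'}" for v
  have finY: "finite (Y v)" for v
  proof (rule finite_subset)
    show "Y v \<subseteq> V" unfolding Y_def sym_arcs_def using arc_in_V by blast
  qed (rule finite_V)
  \<comment> \<open>The sign turns earliest and latest into one minimum.\<close>
  define key where "key v u = (if b then int (pos {u, v}) else - int (pos {u, v}))" for u v
  have Y: "card (Y v) \<le> D" for v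
  proof (cases "Y v = {}")
    case False
    then obtain x where x: "x \<in> Y v" "\<forall>y\<in>Y v. key v x \<le> key v y"
      using finite_has_min_key[OF finY] by blast
    let ?O = "{w. (v, w) \<in> ?G' \<and> zigzag b {x, v} {v, w}}"
    have xE: "{x, v} \<in> E" and "card ?O < D" using x(1) unfolding Y_def sym_arcs_def by auto
    moreover have "Y v - {x} \<subseteq> ?O"
    proof
      fix y assume y: "y \<in> Y v - {x}"
      then have yE: "{y, v} \<in> E" unfolding Y_def sym_arcs_def by auto
      have "{y, v} \<noteq> {x, v}" using y by (auto simp: doubleton_eq_iff)
      then have "pos {y, v} \<noteq> pos {x, v}" using inj_pos xE yE by (auto dest: inj_onD)
      moreover have "key v x \<le> key v y" using x y by blast
      ultimately have "zigzag b {x, v} {v, y}"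
        by (auto simp: zigzag_def key_def insert_commute split: if_splits)
      then show "y \<in> ?O" using y unfolding Y_def by simp
    qed
    moreover have "finite ?O"
    proof (rule finite_subset)
      show "?O \<subseteq> V" using good_subset arc_in_V by (fastforce simp: sym_arcs_def)
    qed (rule finite_V)
    ultimately have "card (Y v - {x}) < D" by (meson card_mono le_less_trans)
    then show ?thesis using x(1) finY by (simp add: card_Diff_singleton)
  qed simp
  have "sym_arcs E - ?G \<subseteq> (\<Union>v\<in>V. (\<lambda>u. (u, v)) ` Y v) \<union> prod.swap ` (sym_arcs E - ?G')"
  proof
    fix z assume z: "z \<in> sym_arcs E - ?G"
    obtain u v where uv: "z = (u, v)" by (cases z)
    have E: "{u, v} \<in> E" using z uv by (simp add: sym_arcs_def)
    show "z \<in> (\<Union>v\<in>V. (\<lambda>u. (u, v)) ` Y v) \<union> prod.swap ` (sym_arcs E - ?G')"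
    proof (cases "(v, u) \<in> ?G'")
      case True
      then have "u \<in> Y v" using z uv unfolding Y_def by simp
      then show ?thesis using arc_in_V[OF E] uv by blast
    next
      case False
      then have "(v, u) \<in> sym_arcs E - ?G'" using E by (simp add: sym_arcs_def insert_commute)
      then have "prod.swap (v, u) \<in> prod.swap ` (sym_arcs E - ?G')" by (rule imageI)
      then show ?thesis using uv by simp
    qed
  qed
  then have "card (sym_arcs E - ?G) \<le> card ((\<Union>v\<in>V. (\<lambda>u. (u, v)) ` Y v) \<union> prod.swap ` (sym_arcs E - ?G'))"
    using finite_V finY finite_arcs by (intro card_mono) auto
  also have "\<dots> \<le> card (\<Union>v\<in>V. (\<lambda>u. (u, v)) ` Y v) + card (prod.swap ` (sym_arcs E - ?G'))"
    by (rule card_Un_le)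
  also have "\<dots> \<le> card V * D + card (sym_arcs E - ?G')"
  proof (rule add_mono)
    show "card (\<Union>v\<in>V. (\<lambda>u. (u, v)) ` Y v) \<le> card V * D"
      using finite_V by (intro card_UN_le_mult) (auto intro: le_trans[OF card_image_le[OF finY] Y])
    show "card (prod.swap ` (sym_arcs E - ?G')) \<le> card (sym_arcs E - ?G')"
      using finite_arcs by (intro card_image_le) auto
  qed
  finally show ?thesis .
qed

lemma card_not_good: "card (sym_arcs E - good D j b) \<le> j * (card V * D)"
proof (induction j arbitrary: b)
  case (Suc j)
  show ?case using card_not_good_step[of D j b] Suc.IH[of "\<not> b"] by simp
qed simp

lemma card_E_le_arcs: "card E \<le> card (sym_arcs E)"
proof -
  have "E \<subseteq> (\<lambda>(u, v). {u, v}) ` sym_arcs E"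
  proof
    fix e assume e: "e \<in> E"
    then have "card e = 2" using graph by (auto simp: simple_graph_def)
    then obtain u v where "e = {u, v}" by (meson card_2_iff)
    then show "e \<in> (\<lambda>(u, v). {u, v}) ` sym_arcs E"
      using e by (intro image_eqI[of _ _ "(u, v)"]) (auto simp: sym_arcs_def)
  qed
  then show ?thesis using finite_arcs by (rule surj_card_le[rotated])
qed

section \<open>Lower bound: growing walks edge by edge\<close>

definition load :: "'a list \<Rightarrow> nat \<Rightarrow> 'a \<Rightarrow> nat" where
  "load p m v = card {w. {v, w} \<in> E \<and> (\<exists>i<m. R (edge p i) {v, w})}"

text \<open>Besides being extendable, a prefix must not end in a vertex where too many edges conflict
  with its earlier edges. The last edge is not counted: its \<open>\<Delta>\<close> conflicts are avoided in the
  next step.\<close>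

definition prefixes :: "nat \<Rightarrow> nat \<Rightarrow> 'a list set" where
  "prefixes q m = {p. zpath m p \<and>
     (p ! (m - 1), p ! m) \<in> good (4 * q) (k - m) (odd m) \<and> load p (m - 1) (p ! m) \<le> q}"

lemma zpath_snoc:
  assumes p: "zpath m p" and m: "1 \<le> m" and E: "{p ! m, w} \<in> E"
    and z: "zigzag (odd m) (edge p (m - 1)) {p ! m, w}"
    and R: "\<And>i. i < m \<Longrightarrow> \<not> R (edge p i) {p ! m, w}"
  shows "zpath (Suc m) (p @ [w])"
proof -
  have len: "length p = Suc m" using zpath_length[OF p] .
  have old: "edge (p @ [w]) i = edge p i" if "i < m" for i
    using that len by (simp add: nth_append)
  have new: "edge (p @ [w]) m = {p ! m, w}" using len by (simp add: nth_append)
  have "zigzag (even i) (edge (p @ [w]) i) (edge (p @ [w]) (Suc i))" if i: "Suc i < Suc m" for i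
  proof (cases "Suc i < m")
    case True
    then have "zigzag (even i) (edge p i) (edge p (Suc i))" using p unfolding zpath_def by blast
    then show ?thesis using old[of i] old[of "Suc i"] True by simp
  next
    case False
    then have "m = Suc i" using i by simp
    then show ?thesis using z old[of i] new by simp
  qed
  moreover have "edge (p @ [w]) i \<in> E" if "i < Suc m" for i
    using that E old[of i] new zpath_edge[OF p, of i] by (cases "i = m") auto
  moreover have "\<not> R (edge (p @ [w]) i) (edge (p @ [w]) j)" if "j < Suc m" "i < j" for i j
    using that R[of i] old[of i] old[of j] new zpath_avoid[OF p, of i j] by (cases "j = m") auto
  ultimately show ?thesis unfolding zpath_def using len by simp
qed

text \<open>Double counting: the edges in conflict with \<open>p\<close> have at most
  \<open>2 * k * \<Delta> \<le> q * q\<close> orientations, and each overloaded vertex is the tail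
  of more than \<open>q\<close> of them.\<close>

lemma card_overloaded:
  assumes p: "zpath m p" and "m \<le> k" and q: "\<Delta> \<le> q" "2 * k \<le> q"
  shows "card {v \<in> V. q < load p m v} \<le> q"
proof -
  let ?B = "{v \<in> V. q < load p m v}"
  define N where "N = {x \<in> E. \<exists>i<m. R (edge p i) x}"
  have "card (Sigma ?B (\<lambda>v. {w. (v, w) \<in> sym_arcs N})) \<le> card (sym_arcs N)"
    using finite_arcs by (intro card_mono) (auto simp: N_def sym_arcs_def elim: rev_finite_subset)
  also have "\<dots> \<le> 2 * card N" by (rule card_arcs_le) (auto simp: N_def)
  also have "\<dots> \<le> 2 * (m * \<Delta>)" using card_conflicts_zpath[OF p] by (simp add: N_def)
  also have "\<dots> \<le> 2 * (k * q)" using assms by (intro mult_left_mono mult_mono) auto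
  also have "\<dots> \<le> q * q" using q by (simp add: mult_le_mono1 flip: mult.assoc)
  finally have le: "card (Sigma ?B (\<lambda>v. {w. (v, w) \<in> sym_arcs N})) \<le> q * q" .
  have fin: "finite {w. (v, w) \<in> sym_arcs N}" for v
    by (rule finite_subset[OF _ finite_V]) (auto simp: N_def sym_arcs_def dest: arc_in_V)
  have "card ?B * Suc q = (\<Sum>v\<in>?B. Suc q)" by simp
  also have "\<dots> \<le> (\<Sum>v\<in>?B. card {w. (v, w) \<in> sym_arcs N})"
    by (rule sum_mono) (auto simp: load_def N_def sym_arcs_def)
  also have "\<dots> = card (Sigma ?B (\<lambda>v. {w. (v, w) \<in> sym_arcs N}))"
    using finite_V fin by (subst card_SigmaI) auto
  finally have "card ?B * Suc q \<le> q * q" using le by simp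
  show ?thesis
  proof (rule ccontr)
    assume "\<not> ?thesis"
    then have "Suc q * Suc q \<le> card ?B * Suc q" by (intro mult_le_mono1) simp
    then show False using \<open>card ?B * Suc q \<le> q * q\<close> by simp
  qed
qed

text \<open>This explains the \<open>4 * q\<close> in \<open>prefixes\<close>: of the
  \<open>4 * q\<close> continuations of the last arc, \<open>q\<close> may conflict with the earlier
  edges (by \<open>load\<close>), \<open>q\<close> with the last edge (by
  \<open>\<Delta> \<le> q\<close>), and \<open>q\<close> may end in an overloaded vertex. The
  remaining \<open>q\<close> keep the invariant.\<close>

lemma card_extensions:
  assumes p: "p \<in> prefixes q m" and m: "1 \<le> m" "m < k" and q: "\<Delta> \<le> q" "2 * k \<le> q"
  shows "q \<le> card {w. p @ [w] \<in> prefixes q (Suc m)}"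
    and "finite {w. p @ [w] \<in> prefixes q (Suc m)}"
proof -
  let ?X = "{w. p @ [w] \<in> prefixes q (Suc m)}"
  have zp: "zpath m p" and gd: "(p ! (m - 1), p ! m) \<in> good (4 * q) (k - m) (odd m)"
    and ld: "load p (m - 1) (p ! m) \<le> q"
    using p unfolding prefixes_def by auto
  have len: "length p = Suc m" using zpath_length[OF zp] .
  have m1: "Suc (m - 1) = m" using m by simp
  let ?O = "{w. (p ! m, w) \<in> good (4 * q) (k - Suc m) (\<not> odd m) \<and>
    zigzag (odd m) {p ! (m - 1), p ! m} {p ! m, w}}"
  have "k - m = Suc (k - Suc m)" using m by simp
  then have O: "4 * q \<le> card ?O" using gd by simp
  let ?B1 = "{w. {p ! m, w} \<in> E \<and> (\<exists>i<m - 1. R (edge p i) {p ! m, w})}"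
  let ?B2 = "{w. {p ! m, w} \<in> E \<and> R (edge p (m - 1)) {p ! m, w}}"
  let ?B3 = "{v \<in> V. q < load p m v}"
  have B1: "card ?B1 \<le> q" using ld unfolding load_def .
  have B2: "card ?B2 \<le> q"
  proof -
    have "card ?B2 \<le> card {e \<in> E. R (edge p (m - 1)) e}"
    proof (rule card_inj_on_le[of "\<lambda>w. {p ! m, w}"])
      show "inj_on (\<lambda>w. {p ! m, w}) ?B2" by (auto intro!: inj_onI simp: doubleton_eq_iff)
    qed (use finite_E in auto)
    also have "\<dots> \<le> \<Delta>" using zpath_edge[OF zp, of "m - 1"] m by (intro R_deg) simp
    finally show ?thesis using q by simp
  qed
  have B3: "card ?B3 \<le> q" using card_overloaded[OF zp _ q] m by simp
  have finV: "finite S" if "\<And>w. w \<in> S \<Longrightarrow> {p ! m, w} \<in> E" for S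
    by (rule finite_subset[OF _ finite_V]) (use that arc_in_V in blast)
  show finX: "finite ?X"
  proof (rule finV)
    fix w assume "w \<in> ?X"
    then have "zpath (Suc m) (p @ [w])" by (simp add: prefixes_def)
    from zpath_edge[OF this, of m] show "{p ! m, w} \<in> E" using len by (simp add: nth_append)
  qed
  have "?O - (?B1 \<union> ?B2 \<union> ?B3) \<subseteq> ?X"
  proof
    fix w assume w: "w \<in> ?O - (?B1 \<union> ?B2 \<union> ?B3)"
    then have E: "{p ! m, w} \<in> E" using good_subset by (fastforce simp: sym_arcs_def)
    have nR: "\<not> R (edge p i) {p ! m, w}" if "i < m" for i
      using w E that by (cases "i = m - 1") auto
    have "zpath (Suc m) (p @ [w])"
      using w E nR m m1 by (intro zpath_snoc[OF zp]) auto
    moreover have "load (p @ [w]) m w = load p m w"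
    proof -
      have "edge (p @ [w]) i = edge p i" if "i < m" for i using that len by (simp add: nth_append)
      then show ?thesis unfolding load_def by (metis (no_types, lifting))
    qed
    moreover have "load p m w \<le> q" using w arc_in_V[OF E] by auto
    ultimately show "w \<in> ?X" using w len by (simp add: prefixes_def nth_append)
  qed
  then have "card (?O - (?B1 \<union> ?B2 \<union> ?B3)) \<le> card ?X" using finX by (rule card_mono[rotated])
  moreover have "card ?O - card (?B1 \<union> ?B2 \<union> ?B3) \<le> card (?O - (?B1 \<union> ?B2 \<union> ?B3))"
    using finV[of ?B1] finV[of ?B2] finite_V by (intro diff_card_le_card_Diff finite_UnI) auto
  moreover have "card (?B1 \<union> ?B2 \<union> ?B3) \<le> 3 * q"
    using card_Un_le[of "?B1 \<union> ?B2" ?B3] card_Un_le[of ?B1 ?B2] B1 B2 B3 by linarith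
  ultimately show "q \<le> card ?X" using O by linarith
qed

lemma card_prefixes:
  assumes "\<Delta> \<le> q" "2 * k \<le> q" "m < k"
  shows "card (good (4 * q) (k - 1) True) * q ^ m \<le> card (prefixes q (Suc m)) \<and> finite (prefixes q (Suc m))"
  using assms(3)
proof (induction m)
  case 0
  have "card (good (4 * q) (k - 1) True) = card ((\<lambda>(u, v). [u, v]) ` good (4 * q) (k - 1) True)"
    by (rule card_image[symmetric]) (auto intro: inj_onI)
  moreover have "prefixes q (Suc 0) = (\<lambda>(u, v). [u, v]) ` good (4 * q) (k - 1) True"
  proof (intro equalityI subsetI)
    fix p assume p: "p \<in> prefixes q (Suc 0)"
    then have "length p = Suc (Suc 0)" by (simp add: prefixes_def zpath_def)
    then have "p = [p ! 0, p ! 1]" by (auto simp: length_Suc_conv)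
    then show "p \<in> (\<lambda>(u, v). [u, v]) ` good (4 * q) (k - 1) True"
      using p by (intro image_eqI[of _ _ "(p ! 0, p ! 1)"]) (auto simp: prefixes_def)
  next
    fix p assume "p \<in> (\<lambda>(u, v). [u, v]) ` good (4 * q) (k - 1) True"
    then obtain u v where uv: "p = [u, v]" "(u, v) \<in> good (4 * q) (k - 1) True" by auto
    then have "{u, v} \<in> E" using good_subset by (fastforce simp: sym_arcs_def)
    then show "p \<in> prefixes q (Suc 0)" using uv by (simp add: prefixes_def zpath_def load_def)
  qed
  moreover have "finite (good (4 * q) (k - 1) True)"
    using good_subset finite_arcs by (rule finite_subset)
  ultimately show ?case by simp
next
  case (Suc m)
  let ?W = "prefixes q (Suc m)"
  let ?X = "\<lambda>p. {w. p @ [w] \<in> prefixes q (Suc (Suc m))}"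
  have IH: "card (good (4 * q) (k - 1) True) * q ^ m \<le> card ?W" and finW: "finite ?W"
    using Suc by auto
  have ext: "q \<le> card (?X p)" "finite (?X p)" if "p \<in> ?W" for p
    using card_extensions[OF that] assms Suc.prems by auto
  have finW': "finite (prefixes q (Suc (Suc m)))"
  proof (rule finite_subset)
    show "prefixes q (Suc (Suc m)) \<subseteq> {p. set p \<subseteq> V \<and> length p = Suc (Suc (Suc m))}"
      using zpath_in_V unfolding prefixes_def by (auto simp: zpath_def)
  qed (rule finite_lists_length_eq[OF finite_V])
  let ?I = "(\<lambda>(p, w). p @ [w]) ` Sigma ?W ?X"
  have "card (good (4 * q) (k - 1) True) * q ^ Suc m \<le> card ?W * q" using IH by simp
  also have "\<dots> = (\<Sum>p\<in>?W. q)" by simp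
  also have "\<dots> \<le> (\<Sum>p\<in>?W. card (?X p))" using ext by (intro sum_mono) auto
  also have "\<dots> = card (Sigma ?W ?X)" using finW ext by (subst card_SigmaI) auto
  also have "\<dots> = card ?I" by (rule card_image[symmetric]) (auto intro: inj_onI)
  also have "\<dots> \<le> card (prefixes q (Suc (Suc m)))"
    using finW' by (intro card_mono) auto
  finally have "card (good (4 * q) (k - 1) True) * q ^ Suc m
      \<le> card (prefixes q (Suc (Suc m)))" .
  then show ?case using finW' by blast
qed

text \<open>The number of zigzag walks lies between \<open>card V * q ^ k\<close> and the bound of
  \<open>card_zpaths_le\<close>; one factor \<open>card V\<close> cancels.\<close>

theorem size_bound:
  assumes q: "\<Delta> \<le> q" "2 * k \<le> \<Delta>" and n: "card V > 0" and E: "8 * k * card V * q \<le> card E"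
  shows "q ^ k \<le> card V * (k * k * \<Delta>) ^ (k div 2)"
proof -
  let ?n = "card V" and ?G = "good (4 * q) (k - 1) True"
  have finG: "finite ?G" using good_subset finite_arcs by (rule finite_subset)
  have "card (sym_arcs E) = card ?G + card (sym_arcs E - ?G)"
    using card_Un_disjoint[of ?G "sym_arcs E - ?G"] finG finite_arcs good_subset[of "4 * q" "k - 1" True]
    by (simp add: Un_absorb1)
  then have "card E \<le> card ?G + (k - 1) * (?n * (4 * q))"
    using card_E_le_arcs card_not_good[of "4 * q" "k - 1" True] by simp
  also have "\<dots> \<le> card ?G + k * (?n * (4 * q))" by simp
  finally have "card E \<le> card ?G + 4 * (k * (?n * q))" by simp
  moreover have "8 * (k * (?n * q)) \<le> card E" using E by (simp add: mult.assoc)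
  moreover have "1 * (?n * q) \<le> k * (?n * q)" using k_pos by (intro mult_right_mono) auto
  \<comment> \<open>There are at least \<open>8 * k * n * q\<close> arcs with
    \<open>n = card V\<close>, and fewer than half of that number fail to be good over
    \<open>k - 1\<close> levels with \<open>D = 4 * q\<close>.\<close>
  ultimately have G: "?n * q \<le> card ?G" by linarith
  have "?n * q ^ k = ?n * q * q ^ (k - 1)" using k_pos by (cases k) auto
  also have "\<dots> \<le> card ?G * q ^ (k - 1)" using G by simp
  also have "\<dots> \<le> card (prefixes q k)"
    using card_prefixes[of q "k - 1"] q k_pos by auto
  also have "\<dots> \<le> card {p. zpath k p}"
    using card_zpaths_le(2) q k_pos by (intro card_mono) (auto simp: prefixes_def)
  also have "\<dots> \<le> ?n * ?n * (k * k * \<Delta>) ^ (k div 2)" using card_zpaths_le(1) q k_pos by simp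
  finally have "?n * q ^ k \<le> ?n * (?n * (k * k * \<Delta>) ^ (k div 2))" by (simp add: mult.assoc)
  then show ?thesis using n by simp
qed

end


section \<open>The size of a graph with small cuts\<close>

text \<open>The interface between algorithm and counting: the size bound uses no other property of
  the greedy output. The list is the order of insertion.\<close>

definition blocked_order :: "nat \<Rightarrow> nat \<Rightarrow> 'a set list \<Rightarrow> bool" where
  "blocked_order g L es \<longleftrightarrow> distinct es \<and>
     (\<forall>i<length es. \<exists>F. finite F \<and> card F \<le> g \<and>
        (\<forall>u v l. es ! i = {u, v} \<longrightarrow> l \<le> L \<longrightarrow> (u, v) \<notin> sym_arcs (set (take i es) - F) ^^ l))"

lemma relpow_monoD:
  fixes r s :: "('a \<times> 'a) set"
  shows "r \<subseteq> s \<Longrightarrow> (x, y) \<in> r ^^ l \<Longrightarrow> (x, y) \<in> s ^^ l"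
proof (induction l arbitrary: y)
  case (Suc l)
  then obtain z where "(x, z) \<in> r ^^ l" "(z, y) \<in> r" by auto
  then show ?case using Suc.IH Suc.prems(1) by auto
qed simp

text \<open>Markov's inequality: the numbers of sets \<open>F e'\<close> containing \<open>e\<close>
  add up to at most \<open>g * card H\<close> over all \<open>e\<close>, so at most half of the
  edges can exceed \<open>2 * g\<close>.\<close>

lemma card_mostly_light:
  assumes "finite H" and "\<And>e. e \<in> H \<Longrightarrow> finite (F e) \<and> card (F e) \<le> g"
  shows "card H \<le> 2 * card {e \<in> H. card {e' \<in> H. e \<in> F e'} \<le> 2 * g}"
proof -
  let ?G = "{e \<in> H. card {e' \<in> H. e \<in> F e'} \<le> 2 * g}"
  let ?B = "{e \<in> H. \<not> card {e' \<in> H. e \<in> F e'} \<le> 2 * g}"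
  have "card ?B * (2 * g + 1) = (\<Sum>e\<in>?B. 2 * g + 1)" by simp
  also have "\<dots> \<le> (\<Sum>e\<in>?B. card {e' \<in> H. e \<in> F e'})" by (rule sum_mono) auto
  also have "\<dots> \<le> (\<Sum>e\<in>H. card {e' \<in> H. e \<in> F e'})" using assms(1) by (intro sum_mono2) auto
  also have "\<dots> = (\<Sum>e'\<in>H. card {e \<in> H. e \<in> F e'})"
    using sum.swap_restrict[OF assms(1) assms(1), of "\<lambda>_ _. 1::nat" "\<lambda>e e'. e \<in> F e'"] by simp
  also have "\<dots> \<le> (\<Sum>e'\<in>H. g)"
  proof (rule sum_mono)
    fix e' assume "e' \<in> H"
    then have "finite (F e')" "card (F e') \<le> g" using assms(2) by auto
    then show "card {e \<in> H. e \<in> F e'} \<le> g"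
      using card_mono[of "F e'" "{e \<in> H. e \<in> F e'}"] by force
  qed
  finally have "card ?B * (2 * g + 1) \<le> card H * g" by simp
  have "card (?G \<union> ?B) = card ?G + card ?B" using assms(1) by (intro card_Un_disjoint) auto
  moreover have "?G \<union> ?B = H" by auto
  ultimately have H: "card H = card ?G + card ?B" by simp
  have le: "card ?B + g * card ?B \<le> g * card ?G"
    using \<open>card ?B * (2 * g + 1) \<le> card H * g\<close> unfolding H by (simp add: algebra_simps)
  then have "g * card ?B \<le> g * card ?G" by linarith
  then have "card ?B \<le> card ?G" using le by (cases "g = 0") simp_all
  then show ?thesis using H by simp
qed

text \<open>\<open>m\<close> counts the light edges, and discarding the others keeps all blockings
  since walks only disappear. A light edge conflicts with itself, with at most \<open>2 * g\<close>
  edges whose set contains it, and with at most \<open>g\<close> edges of its own set, in total at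
  most \<open>4 * g\<close>. The hypothesis \<open>k \<le> 2 * g\<close> supplies both
  \<open>g \<ge> 1\<close> and the \<open>2 * k \<le> \<Delta>\<close> of
  \<open>size_bound\<close>.\<close>

lemma blocked_order_nat_bound:
  assumes order: "blocked_order g (2 * k - 1) es" and graph: "simple_graph V (set es)"
    and k: "1 \<le> k" and g: "k \<le> 2 * g"
  obtains m where "card (set es) \<le> 2 * m"
    "\<And>q. 4 * g \<le> q \<Longrightarrow> 8 * k * card V * q \<le> m \<Longrightarrow> 0 < card V \<Longrightarrow>
      q ^ k \<le> card V * (k * k * (4 * g)) ^ (k div 2)"
proof -
  let ?H = "set es"
  have dist: "distinct es" using order by (simp add: blocked_order_def)
  define pos where "pos = the_inv_into {..<length es} ((!) es)"
  have inj: "inj_on ((!) es) {..<length es}" using dist by (auto intro!: inj_onI simp: nth_eq_iff_index_eq)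
  have pos_nth: "pos (es ! i) = i" if "i < length es" for i
    unfolding pos_def using inj that by (intro the_inv_into_f_f) auto
  have nth_pos: "pos e < length es" "es ! pos e = e" if "e \<in> ?H" for e
    using that pos_nth by (metis in_set_conv_nth)+
  have "\<forall>e\<in>?H. \<exists>F. finite F \<and> card F \<le> g \<and> (\<forall>u v l. e = {u, v} \<longrightarrow> l \<le> 2 * k - 1 \<longrightarrow>
      (u, v) \<notin> sym_arcs (set (take (pos e) es) - F) ^^ l)"
  proof
    fix e assume e: "e \<in> ?H"
    then have "\<exists>F. finite F \<and> card F \<le> g \<and> (\<forall>u v l. es ! pos e = {u, v} \<longrightarrow> l \<le> 2 * k - 1 \<longrightarrow>
      (u, v) \<notin> sym_arcs (set (take (pos e) es) - F) ^^ l)"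
      using order nth_pos(1) unfolding blocked_order_def by blast
    then show "\<exists>F. finite F \<and> card F \<le> g \<and> (\<forall>u v l. e = {u, v} \<longrightarrow> l \<le> 2 * k - 1 \<longrightarrow>
      (u, v) \<notin> sym_arcs (set (take (pos e) es) - F) ^^ l)"
      using nth_pos(2)[OF e] by simp
  qed
  then obtain F where F: "\<And>e. e \<in> ?H \<Longrightarrow> finite (F e) \<and> card (F e) \<le> g"
    and cut: "\<And>e u v l. e \<in> ?H \<Longrightarrow> e = {u, v} \<Longrightarrow> l \<le> 2 * k - 1 \<Longrightarrow>
      (u, v) \<notin> sym_arcs (set (take (pos e) es) - F e) ^^ l"
    by metis
  define E where "E = {e \<in> ?H. card {e' \<in> ?H. e \<in> F e'} \<le> 2 * g}"
  define R where "R e e' \<longleftrightarrow> e = e' \<or> e \<in> F e' \<or> e' \<in> F e" for e e'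
  have EH: "E \<subseteq> ?H" unfolding E_def by auto
  interpret conflict_graph V E pos R "4 * g" k
  proof
    show "simple_graph V E" using graph EH by (auto simp: simple_graph_def)
    show "inj_on pos E" using nth_pos(2) EH by (metis inj_onI subsetD)
    show "R e e" for e by (simp add: R_def)
    show "R e e' \<Longrightarrow> R e' e" for e e' by (auto simp: R_def)
    show "1 \<le> k" by (rule k)
    show "card {e' \<in> E. R e e'} \<le> 4 * g" if e: "e \<in> E" for e
    proof -
      have "card {e' \<in> E. R e e'} \<le> card ({e} \<union> {e' \<in> ?H. e \<in> F e'} \<union> F e)"
        using F e EH by (intro card_mono) (auto simp: R_def)
      also have "\<dots> \<le> 1 + card {e' \<in> ?H. e \<in> F e'} + card (F e)"
        using card_Un_le[of "{e} \<union> {e' \<in> ?H. e \<in> F e'}" "F e"] card_Un_le[of "{e}" "{e' \<in> ?H. e \<in> F e'}"]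
        by simp
      also have "\<dots> \<le> 1 + 2 * g + g" using e F EH by (intro add_mono) (auto simp: E_def)
      finally show ?thesis using k g by simp
    qed
    show "(u, v) \<notin> sym_arcs {e \<in> E. pos e < pos {u, v} \<and> \<not> R {u, v} e} ^^ l"
      if e: "{u, v} \<in> E" and l: "l \<le> 2 * k - 1" for u v l
    proof
      assume w: "(u, v) \<in> sym_arcs {e \<in> E. pos e < pos {u, v} \<and> \<not> R {u, v} e} ^^ l"
      have "{e \<in> E. pos e < pos {u, v} \<and> \<not> R {u, v} e} \<subseteq> set (take (pos {u, v}) es) - F {u, v}"
      proof
        fix e assume e: "e \<in> {e \<in> E. pos e < pos {u, v} \<and> \<not> R {u, v} e}"
        then have "e \<in> ?H" using EH by auto
        then have "take (pos {u, v}) es ! pos e = e" "pos e < length (take (pos {u, v}) es)"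
          using nth_pos e by auto
        then have "e \<in> set (take (pos {u, v}) es)" by (metis nth_mem)
        then show "e \<in> set (take (pos {u, v}) es) - F {u, v}" using e by (auto simp: R_def)
      qed
      then show False using relpow_monoD[OF sym_arcs_mono w] cut[of "{u, v}" u v l] e l EH by blast
    qed
  qed
  show ?thesis
  proof (rule that)
    show "card ?H \<le> 2 * card E" unfolding E_def using F by (intro card_mostly_light) auto
    show "q ^ k \<le> card V * (k * k * (4 * g)) ^ (k div 2)"
      if "4 * g \<le> q" "8 * k * card V * q \<le> card E" "0 < card V" for q
      using size_bound[of q] that g by auto
  qed
qed

section \<open>Solving the inequality for the number of edges\<close>

lemma powr_half_bound:
  fixes x :: real
  assumes "1 \<le> k" "0 \<le> x" "x \<le> 1 / 2"
  shows "(8 * real k ^ 3) powr x \<le> 3 * real k powr (3 / 2)"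
proof -
  have k3: "1 \<le> real k ^ 3" using assms by (intro one_le_power) auto
  then have "(8 * real k ^ 3) powr x \<le> (8 * real k ^ 3) powr (1 / 2)"
    using assms by (intro powr_mono) linarith+
  also have "\<dots> = sqrt 8 * (real k ^ 3) powr (1 / 2)"
    by (simp add: powr_mult powr_half_sqrt)
  also have "real k ^ 3 = real k powr 3" using assms powr_realpow[of "real k" 3] by simp
  also have "(real k powr 3) powr (1 / 2) = real k powr (3 / 2)" unfolding powr_powr by simp
  also have "sqrt 8 \<le> 3" by (rule real_le_lsqrt) auto
  finally show ?thesis using assms by (simp add: mult_right_mono)
qed

lemma power_powr_inverse:
  fixes x :: real
  assumes "0 < x"
  shows "(x ^ r) powr (1 / real k) = x powr (real r / real k)"
proof -
  have "(x ^ r) powr (1 / real k) = (x powr real r) powr (1 / real k)"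
    using powr_realpow[OF assms] by simp
  then show ?thesis by (simp only: powr_powr) simp
qed

theorem blocked_order_bound:
  fixes f k :: nat and V :: "'a set"
  assumes order: "blocked_order ((2 * k - 1) * f) (2 * k - 1) es" and graph: "simple_graph V (set es)"
    and k: "1 \<le> k" and f: "1 \<le> f"
  shows "real (card (set es)) \<le> 128 * (real k powr (5 / 2) * real f powr (real (k div 2) / real k)
      * real (card V) powr (1 + 1 / real k) + real k ^ 2 * real f * real (card V))"
proof -
  let ?n = "card V" and ?x = "real (k div 2) / real k"
  let ?A = "real k powr (5 / 2) * real f powr ?x * real ?n powr (1 + 1 / real k)"
  let ?B = "real k ^ 2 * real f * real ?n"
  define g where "g = (2 * k - 1) * f"
  have finV: "finite V" using graph by (simp add: simple_graph_def)
  have add_le: "c \<le> 128 * (A + B)" if "0 \<le> A" "0 \<le> B" "c \<le> 128 * A \<or> c \<le> 128 * B" for A B c :: real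
    using that by auto
  have AB: "0 \<le> ?A" "0 \<le> ?B" by simp_all
  show ?thesis
  proof (cases "?n = 0")
    case True
    then have "V = {}" using finV by simp
    then have "False" if "e \<in> set es" for e
      using that graph by (auto simp: simple_graph_def)
    then have "card (set es) = 0" by (metis card.empty equals0I)
    then show ?thesis using AB by simp
  next
    case False
    have k2f: "g \<le> 2 * k * f" unfolding g_def by (rule mult_right_mono) simp_all
    have kg: "k \<le> g" unfolding g_def using k f mult_mono[of k "2 * k - 1" 1 f] by simp
    then have "k \<le> 2 * g" by simp
    then obtain m where m: "card (set es) \<le> 2 * m"
      and bound: "\<And>q. 4 * g \<le> q \<Longrightarrow> 8 * k * ?n * q \<le> m \<Longrightarrow> 0 < ?n \<Longrightarrow>
        q ^ k \<le> ?n * (k * k * (4 * g)) ^ (k div 2)"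
      using blocked_order_nat_bound[OF order[folded g_def] graph k] by blast
    define q where "q = m div (8 * k * ?n)"
    have "0 < 8 * k * ?n" using k False by simp
    then have m_lt: "m < 8 * k * ?n * Suc q"
      unfolding q_def using dividend_less_times_div[of "8 * k * ?n" m] by simp
    have q_le: "8 * k * ?n * q \<le> m" unfolding q_def by (rule times_div_less_eq_dividend)
    show ?thesis
    proof (cases "4 * g \<le> q")
      case False
      then have "Suc q \<le> 8 * k * f" using k2f by simp
      then have "8 * k * ?n * Suc q \<le> 8 * k * ?n * (8 * k * f)" by (rule mult_left_mono) simp
      then have "card (set es) \<le> 2 * (8 * k * ?n * (8 * k * f))" using m m_lt by linarith
      then have "real (card (set es)) \<le> real (2 * (8 * k * ?n * (8 * k * f)))" by (rule of_nat_mono)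
      also have "\<dots> = 128 * ?B" by (simp add: power2_eq_square)
      finally show ?thesis using add_le[OF AB] by blast
    next
      case True
      have "1 \<le> g" using k kg by simp
      then have q1: "1 \<le> q" using True by simp
      have "q ^ k \<le> ?n * (k * k * (4 * g)) ^ (k div 2)" using bound[OF True q_le] \<open>?n \<noteq> 0\<close> by simp
      \<comment> \<open>\<open>g \<le> 2 * k * f\<close> turns the base into
        \<open>8 * k^3 * f\<close>. Its root has exponent at most \<open>1/2\<close>, which leaves
        \<open>sqrt 8 \<le> 3\<close> and \<open>k^(3/2)\<close>.\<close>
      also have "\<dots> \<le> ?n * (8 * k ^ 3 * f) ^ (k div 2)"
        using mult_left_mono[OF k2f, of "4 * k * k"]
        by (intro mult_left_mono power_mono) (simp_all add: power3_eq_cube algebra_simps)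
      finally have "real (q ^ k) \<le> real (?n * (8 * k ^ 3 * f) ^ (k div 2))" by (rule of_nat_mono)
      then have qk: "real q ^ k \<le> real ?n * (8 * real k ^ 3 * real f) ^ (k div 2)" by simp
      have pos: "0 < 8 * real k ^ 3 * real f" using k f by simp
      have "real q = (real q ^ k) powr (1 / real k)"
        using k q1 power_powr_inverse[of "real q" k k] by simp
      also have "\<dots> \<le> (real ?n * (8 * real k ^ 3 * real f) ^ (k div 2)) powr (1 / real k)"
        using qk by (intro powr_mono2) auto
      also have "\<dots> = real ?n powr (1 / real k) * (8 * real k ^ 3 * real f) powr ?x"
        unfolding powr_mult power_powr_inverse[OF pos] ..
      also have "(8 * real k ^ 3 * real f) powr ?x = (8 * real k ^ 3) powr ?x * real f powr ?x"
        by (rule powr_mult)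
      finally have "real q \<le> real ?n powr (1 / real k) * ((8 * real k ^ 3) powr ?x * real f powr ?x)" .
      also have "\<dots> \<le> real ?n powr (1 / real k) * ((3 * real k powr (3 / 2)) * real f powr ?x)"
      proof -
        have "real (k div 2) \<le> real k / 2" by linarith
        then have "?x \<le> 1 / 2" using k by (simp add: field_simps)
        then show ?thesis using powr_half_bound[OF k, of ?x] by (intro mult_left_mono mult_right_mono) auto
      qed
      finally have q_real: "real q \<le> 3 * real ?n powr (1 / real k) * real k powr (3 / 2) * real f powr ?x"
        by (simp add: mult_ac)
      have "card (set es) \<le> 2 * (8 * k * ?n * Suc q)" using m m_lt by linarith
      also have "\<dots> \<le> 2 * (8 * k * ?n * (2 * q))" using q1 by (intro mult_left_mono) auto
      finally have "real (card (set es)) \<le> real (2 * (8 * k * ?n * (2 * q)))" by (rule of_nat_mono)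
      also have "\<dots> = 32 * real k * real ?n * real q" by simp
      also have "\<dots> \<le> 32 * real k * real ?n * (3 * real ?n powr (1 / real k) * real k powr (3 / 2) * real f powr ?x)"
        using q_real by (intro mult_left_mono) auto
      also have "\<dots> = 96 * ((real k * real k powr (3 / 2)) * real f powr ?x * (real ?n * real ?n powr (1 / real k)))"
        by (simp add: mult_ac)
      also have "real k * real k powr (3 / 2) = real k powr (5 / 2)"
        using k powr_add[of "real k" 1 "3 / 2"] by simp
      also have "real ?n * real ?n powr (1 / real k) = real ?n powr (1 + 1 / real k)"
        using \<open>?n \<noteq> 0\<close> by (simp add: powr_add)
      finally have "real (card (set es)) \<le> 96 * ?A" .
      then have "real (card (set es)) \<le> 128 * ?A" using AB(1) by linarith
      then show ?thesis using add_le[OF AB] by blast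
    qed
  qed
qed

lemma half_div_odd:
  assumes "odd k"
  shows "real (k div 2) / real k = 1 / 2 - 1 / (2 * real k)"
proof -
  obtain r where r: "k = 2 * r + 1" using assms by (elim oddE)
  then show ?thesis by (simp add: field_simps)
qed

lemma half_div_even: "even k \<Longrightarrow> 1 \<le> k \<Longrightarrow> real (k div 2) / real k = 1 / 2"
  by (auto elim!: evenE)


section \<open>Stretch\<close>

lemma orient_sel:
  "verts (orient V X) = V" "arcs (orient V X) = {(u, v). {u, v} \<in> X}"
  "tail (orient V X) = fst" "head (orient V X) = snd"
  by (simp_all add: orient_def)

lemma awalk_of_relpow:
  fixes V :: "'a set"
  assumes X: "simple_graph V X" and Y: "Y \<subseteq> X" "\<And>h. h \<in> Y \<Longrightarrow> w h \<le> c" and b: "b \<in> V"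
    and walk: "(a, b) \<in> sym_arcs Y ^^ l"
  shows "\<exists>q. pre_digraph.awalk (orient V X) a q b \<and> (\<Sum>(u, v)\<leftarrow>q. w {u, v}) \<le> real l * c"
  using walk
proof (induction l arbitrary: a)
  interpret wf_digraph "orient V X" using X by (rule wf_digraph_orient)
  case 0
  then have "awalk a [] b" using b by (simp add: awalk_Nil_iff orient_sel(1))
  then show ?case by (intro exI[of _ "[]"]) auto
next
  interpret wf_digraph "orient V X" using X by (rule wf_digraph_orient)
  case (Suc l)
  then obtain x where x: "(a, x) \<in> sym_arcs Y" "(x, b) \<in> sym_arcs Y ^^ l"
    by (meson relpow_Suc_D2)
  then obtain q where q: "awalk x q b" "(\<Sum>(u, v)\<leftarrow>q. w {u, v}) \<le> real l * c"
    using Suc.IH by blast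
  have "{a, x} \<in> Y" using x by (simp add: sym_arcs_def)
  then have "awalk a ((a, x) # q) b" and "w {a, x} \<le> c"
    using q(1) Y by (auto simp: awalk_Cons_iff orient_sel)
  then show ?case using q(2) by (intro exI[of _ "(a, x) # q"]) (auto simp: algebra_simps)
qed

lemma gdist_eq:
  assumes "simple_graph V X"
  shows "gdist V X w u v =
    (INF p\<in>{p. pre_digraph.awalk (orient V X) u p v}. ereal (\<Sum>(a, b)\<leftarrow>p. w {a, b}))"
proof -
  interpret wf_digraph "orient V X" using assms by (rule wf_digraph_orient)
  show ?thesis unfolding gdist_def \<mu>_def awalk_cost_def ..
qed

text \<open>Stretch need only be checked on single edges: every edge of a walk outside
  \<open>F\<close> is kept or replaced by at most \<open>L\<close> edges of \<open>H - F\<close>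
  that are no heavier. Nonnegative lengths then allow \<open>l\<close> to be replaced by
  \<open>L\<close>.\<close>

lemma eft_spannerI:
  fixes V :: "'a set"
  assumes E: "simple_graph V E" and w: "\<And>e. e \<in> E \<Longrightarrow> 0 \<le> w e" and H: "H \<subseteq> E" and L: "1 \<le> L"
    and bypass: "\<And>u v F. {u, v} \<in> E - H \<Longrightarrow> finite F \<Longrightarrow> card F \<le> f \<Longrightarrow>
      \<exists>l\<le>L. (u, v) \<in> sym_arcs ({h \<in> H. w h \<le> w {u, v}} - F) ^^ l"
  shows "eft_spanner f (real L) V E w H"
  unfolding eft_spanner_def
proof (intro conjI allI impI ballI)
  fix F u v assume F: "F \<subseteq> E \<and> card F \<le> f" and u: "u \<in> V" and v: "v \<in> V"
  \<comment> \<open>An infinite set has \<open>card\<close> 0, so finiteness of \<open>F\<close> has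
    to come from \<open>F \<subseteq> E\<close>.\<close>
  have "E \<subseteq> Pow V" "finite V" using E by (auto simp: simple_graph_def)
  then have finF: "finite F" using F by (auto intro: finite_subset[of F "Pow V"])
  have EF: "simple_graph V (E - F)" and HF: "simple_graph V (H - F)"
    using E H by (auto simp: simple_graph_def)
  interpret EF: wf_digraph "orient V (E - F)" using EF by (rule wf_digraph_orient)
  interpret HF: wf_digraph "orient V (H - F)" using HF by (rule wf_digraph_orient)
  have walk: "\<exists>q. HF.awalk a q v \<and> (\<Sum>(a, b)\<leftarrow>q. w {a, b}) \<le> real L * (\<Sum>(a, b)\<leftarrow>p. w {a, b})"
    if "EF.awalk a p v" for a p
    using that
  proof (induction p arbitrary: a)
    case Nil
    then have "HF.awalk a [] v" by (auto simp: EF.awalk_Nil_iff HF.awalk_Nil_iff orient_sel)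
    then show ?case by (intro exI[of _ "[]"]) auto
  next
    case (Cons e p)
    obtain x where e: "e = (a, x)" "{a, x} \<in> E - F" "EF.awalk x p v"
      using Cons.prems by (cases e) (auto simp: EF.awalk_Cons_iff orient_sel)
    have x: "x \<in> V" using e(2) E by (auto simp: simple_graph_def)
    have w0: "0 \<le> w {a, x}" using w e by auto
    obtain q where q: "HF.awalk x q v" "(\<Sum>(a, b)\<leftarrow>q. w {a, b}) \<le> real L * (\<Sum>(a, b)\<leftarrow>p. w {a, b})"
      using Cons.IH e(3) by blast
    have "\<exists>l\<le>L. (a, x) \<in> sym_arcs ({h \<in> H. w h \<le> w {a, x}} - F) ^^ l"
    proof (cases "{a, x} \<in> H")
      case True
      then have "(a, x) \<in> sym_arcs ({h \<in> H. w h \<le> w {a, x}} - F) ^^ 1"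
        using e by (simp add: sym_arcs_def)
      then show ?thesis using L by blast
    next
      case False
      then show ?thesis using bypass finF F e by blast
    qed
    then obtain l where l: "l \<le> L" "(a, x) \<in> sym_arcs ({h \<in> H. w h \<le> w {a, x}} - F) ^^ l" by blast
    have Y: "{h \<in> H. w h \<le> w {a, x}} - F \<subseteq> H - F" by blast
    obtain r where r: "HF.awalk a r x" "(\<Sum>(u, v)\<leftarrow>r. w {u, v}) \<le> real l * w {a, x}"
      using awalk_of_relpow[OF HF Y _ x l(2), of w "w {a, x}"] by blast
    have "HF.awalk a (r @ q) v" using r q by (simp add: HF.awalk_appendI)
    moreover have "(\<Sum>(u, v)\<leftarrow>r @ q. w {u, v}) \<le> real L * (\<Sum>(u, v)\<leftarrow>e # p. w {u, v})"
    proof -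
      have "real l * w {a, x} \<le> real L * w {a, x}" using l w0 by (intro mult_right_mono) simp_all
      then have "(\<Sum>(u, v)\<leftarrow>r. w {u, v}) + (\<Sum>(u, v)\<leftarrow>q. w {u, v})
          \<le> real L * w {a, x} + real L * (\<Sum>(u, v)\<leftarrow>p. w {u, v})"
        using r(2) q(2) by linarith
      then show ?thesis unfolding e(1) by (simp add: distrib_left)
    qed
    ultimately show ?case by blast
  qed
  have "gdist V (H - F) w u v \<le> ereal (real L) * ereal (\<Sum>(a, b)\<leftarrow>p. w {a, b})"
    if p: "EF.awalk u p v" for p
  proof -
    obtain q where q: "HF.awalk u q v" "(\<Sum>(a, b)\<leftarrow>q. w {a, b}) \<le> real L * (\<Sum>(a, b)\<leftarrow>p. w {a, b})"
      using walk[OF p] by blast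
    then have "gdist V (H - F) w u v \<le> ereal (\<Sum>(a, b)\<leftarrow>q. w {a, b})"
      unfolding gdist_eq[OF HF] by (intro INF_lower) auto
    also have "\<dots> \<le> ereal (real L) * ereal (\<Sum>(a, b)\<leftarrow>p. w {a, b})" using q by simp
    finally show ?thesis .
  qed
  moreover have L0: "0 < ereal (real L)" "ereal (real L) \<noteq> \<infinity>" using L by simp_all
  \<comment> \<open>Dividing by \<open>L\<close> isolates the infimum on the right; the disconnected
    case is then the infimum of the empty set.\<close>
  ultimately have "gdist V (H - F) w u v / ereal (real L) \<le> gdist V (E - F) w u v"
    unfolding gdist_eq[OF EF] by (intro INF_greatest) (simp add: ereal_divide_le_pos[OF L0])
  then show "gdist V (H - F) w u v \<le> ereal (real L) * gdist V (E - F) w u v"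
    unfolding ereal_divide_le_pos[OF L0] .
qed (rule H)


section \<open>Running programs\<close>

text \<open>Total correctness with a time bound. The real memory \<open>r\<close> is the same before
  and after because the program only reads edge lengths, so assertions concern the natural memory
  alone.\<close>

definition runs ::
    "rstore \<Rightarrow> com \<Rightarrow> nstore \<Rightarrow> nat \<Rightarrow> (nstore \<Rightarrow> bool) \<Rightarrow> bool" where
  "runs r c m T Q \<longleftrightarrow> (\<exists>t m'. exec c (m, r) t (m', r) \<and> t \<le> T \<and> Q m')"

lemma runs_conseq: "runs r c m T Q \<Longrightarrow> T \<le> T' \<Longrightarrow> (\<And>m'. Q m' \<Longrightarrow> Q' m') \<Longrightarrow> runs r c m T' Q'"
  unfolding runs_def by (meson le_trans)

lemma runs_Skip: "Q m \<Longrightarrow> runs r Skip m 1 Q"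
  unfolding runs_def using exec.Skip by blast

lemma runs_assign: "Q (store m x (map (neval m) js) (neval m a)) \<Longrightarrow> runs r (NAssign x js a) m 1 Q"
  unfolding runs_def using exec.NAssign by blast

lemma runs_Seq: "runs r c m T (\<lambda>m'. runs r c' m' T' Q) \<Longrightarrow> runs r (Seq c c') m (T + T') Q"
  unfolding runs_def by (meson add_mono exec.Seq)

text \<open>The bounds of the branches are added, not maximized, so that every time bound stays a
  polynomial expression.\<close>

lemma runs_Cond:
  assumes "beval (m, r) b \<Longrightarrow> runs r c m T Q" "\<not> beval (m, r) b \<Longrightarrow> runs r c' m T' Q"
  shows "runs r (Cond b c c') m (1 + T + T') Q"
proof (cases "beval (m, r) b")
  case True
  then obtain t m' where "exec c (m, r) t (m', r)" "t \<le> T" "Q m'" using assms(1) by (auto simp: runs_def)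
  then show ?thesis unfolding runs_def using exec.CondTrue[OF True]
    by (intro exI[of _ "1 + t"] exI[of _ m']) auto
next
  case False
  then obtain t m' where "exec c' (m, r) t (m', r)" "t \<le> T'" "Q m'" using assms(2) by (auto simp: runs_def)
  then show ?thesis unfolding runs_def using exec.CondFalse[OF False]
    by (intro exI[of _ "1 + t"] exI[of _ m']) auto
qed

abbreviation nvar :: "string \<Rightarrow> nexp" where "nvar x \<equiv> NVar x []"

definition For :: "string \<Rightarrow> string \<Rightarrow> com \<Rightarrow> com" where
  "For x N c = Seq (NAssign x [] (NConst 0))
     (While (NLess (nvar x) (nvar N)) (Seq c (NAssign x [] (NAdd (nvar x) (NConst 1)))))"

text \<open>Each round pays 2 extra steps for the test and the increment; the final 2 are the
  initialization and the failing test.\<close>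

definition for_time :: "nat \<Rightarrow> nat \<Rightarrow> nat" where
  "for_time n T = n * (T + 2) + 2"

text \<open>The invariant has to tolerate arbitrary values of the counter (\<open>index\<close>), so
  the increment cannot destroy it; the body has to return counter and limit unchanged.\<close>

lemma runs_While:
  assumes step: "\<And>i m. i < n \<Longrightarrow> I i m \<Longrightarrow> m x [] = i \<Longrightarrow> m N [] = n \<Longrightarrow>
      runs r c m T (\<lambda>m'. I (Suc i) m' \<and> m' x [] = i \<and> m' N [] = n)"
    and index: "\<And>i m a. I i m \<Longrightarrow> I i (store m x [] a)"
    and ne: "x \<noteq> N"
  shows "I i m \<Longrightarrow> m x [] = i \<Longrightarrow> m N [] = n \<Longrightarrow> i \<le> n \<Longrightarrow>
    runs r (While (NLess (nvar x) (nvar N)) (Seq c (NAssign x [] (NAdd (nvar x) (NConst 1))))) m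
      ((n - i) * (T + 2) + 1) (I n)"
proof (induction "n - i" arbitrary: i m)
  case 0
  then have "\<not> beval (m, r) (NLess (nvar x) (nvar N))" "I n m" by auto
  then show ?case unfolding runs_def using exec.WhileFalse by (meson le_add2)
next
  case (Suc d)
  then have i: "i < n" by simp
  let ?w = "While (NLess (nvar x) (nvar N)) (Seq c (NAssign x [] (NAdd (nvar x) (NConst 1))))"
  obtain t1 m1 where m1: "exec c (m, r) t1 (m1, r)" "t1 \<le> T" "I (Suc i) m1" "m1 x [] = i" "m1 N [] = n"
    using step[OF i Suc.prems(1-3)] by (auto simp: runs_def)
  let ?m2 = "store m1 x [] (Suc i)"
  have inc: "exec (NAssign x [] (NAdd (nvar x) (NConst 1))) (m1, r) 1 (?m2, r)"
    using exec.NAssign[of x "[]" "NAdd (nvar x) (NConst 1)" m1 r] m1 by simp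
  have "I (Suc i) ?m2" using index m1 by blast
  moreover have "?m2 x [] = Suc i" "?m2 N [] = n" using m1 ne by (simp_all add: store_def)
  moreover have "d = n - Suc i" using Suc.hyps(2) by simp
  ultimately obtain t2 m3 where m3: "exec ?w (?m2, r) t2 (m3, r)" "t2 \<le> (n - Suc i) * (T + 2) + 1" "I n m3"
    using Suc.hyps(1)[of "Suc i" ?m2] i by (auto simp: runs_def)
  have "beval (m, r) (NLess (nvar x) (nvar N))" using i Suc.prems by simp
  then have "exec ?w (m, r) (1 + (t1 + 1) + t2) (m3, r)"
    using exec.WhileTrue exec.Seq[OF m1(1) inc] m3(1) by blast
  moreover have "(n - i) * (T + 2) = (T + 2) + (n - Suc i) * (T + 2)"
    unfolding Suc_diff_Suc[OF i, symmetric] by (rule mult_Suc)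
  then have "1 + (t1 + 1) + t2 \<le> (n - i) * (T + 2) + 1" using m1(2) m3(2) by linarith
  ultimately show ?case unfolding runs_def using m3(3) by blast
qed

lemma runs_For:
  assumes ne: "x \<noteq> N" and N: "m N [] = n" and init: "I 0 m"
    and index: "\<And>i m a. I i m \<Longrightarrow> I i (store m x [] a)"
    and step: "\<And>i m. i < n \<Longrightarrow> I i m \<Longrightarrow> m x [] = i \<Longrightarrow> m N [] = n \<Longrightarrow>
      runs r c m T (\<lambda>m'. I (Suc i) m' \<and> m' x [] = i \<and> m' N [] = n)"
    and fin: "\<And>m'. I n m' \<Longrightarrow> Q m'"
  shows "runs r (For x N c) m (for_time n T) Q"
proof -
  let ?m = "store m x [] 0"
  have "I 0 ?m" by (rule index[OF init])
  moreover have "?m x [] = 0" "?m N [] = n" using N ne by (simp_all add: store_def)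
  ultimately have "runs r (While (NLess (nvar x) (nvar N)) (Seq c (NAssign x [] (NAdd (nvar x) (NConst 1))))) ?m
      ((n - 0) * (T + 2) + 1) (I n)"
    by (intro runs_While[OF step index ne]) simp_all
  then have "runs r (For x N c) m (1 + (n * (T + 2) + 1)) (I n)"
    unfolding For_def by (intro runs_Seq runs_assign) simp
  then show ?thesis by (rule runs_conseq) (simp_all add: for_time_def fin)
qed

definition same :: "string list \<Rightarrow> nstore \<Rightarrow> nstore \<Rightarrow> bool" where
  "same xs m m' \<longleftrightarrow> (\<forall>x\<in>set xs. m' x = m x)"

lemma store_same [simp]: "store m x js a x = (m x)(js := a)"
  by (simp add: store_def)

lemma store_other: "y \<noteq> x \<Longrightarrow> store m x js a y = m y"
  by (simp add: store_def)

abbreviation inputs :: "string list" where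
  "inputs \<equiv> [''n'', ''f'', ''k'', ''nn'', ''nn1'', ''kk'', ''adj'']"


section \<open>Packing short walks\<close>

abbreviation nz :: "nexp \<Rightarrow> bexp" where "nz a \<equiv> NLess (NConst 0) a"

text \<open>The cell \<open>R[l, y]\<close> tells whether a walk of exactly \<open>l\<close> edges leads from \<open>u\<close> to \<open>y\<close>. The edges
  used by the packing are marked in \<open>rem\<close>, which is also indexed by the counter \<open>it\<close> of the main
  loop, so that it need not be cleared.\<close>

definition bfs_row :: com where
  "bfs_row = Seq (NAssign ''R'' [NAdd (nvar ''l'') (NConst 1), nvar ''y''] (NConst 0))
     (For ''x'' ''n'' (Cond (BAnd (nz (NVar ''R'' [nvar ''l'', nvar ''x'']))
          (BAnd (nz (NVar ''out'' [nvar ''x'', nvar ''y''])) (BNot (nz (NVar ''rem'' [nvar ''it'', nvar ''x'', nvar ''y''])))))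
        (Seq (NAssign ''R'' [NAdd (nvar ''l'') (NConst 1), nvar ''y''] (NConst 1))
          (NAssign ''par'' [NAdd (nvar ''l'') (NConst 1), nvar ''y''] (nvar ''x''))) Skip))"

definition bfs :: com where
  "bfs = Seq (For ''x'' ''n'' (NAssign ''R'' [NConst 0, nvar ''x''] (NConst 0)))
     (Seq (NAssign ''R'' [NConst 0, nvar ''u''] (NConst 1))
        (For ''l'' ''nn'' (For ''y'' ''n'' bfs_row)))"

abbreviation bfs_keep :: "string list" where
  "bfs_keep \<equiv> inputs @ [''it'', ''u'', ''v'', ''cnt'', ''q'', ''out'', ''rem'', ''done'']"

definition bfs_row_time :: "nat \<Rightarrow> nat" where
  "bfs_row_time n = 1 + for_time n (1 + (1 + 1) + 1)"

definition alive :: "nstore \<Rightarrow> (nat \<times> nat) set" where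
  "alive m = {(a, b). 0 < m ''out'' [a, b] \<and> m ''rem'' [m ''it'' [], a, b] = 0}"

text \<open>The last predecessor found overwrites the earlier ones in \<open>par\<close>; any of
  them is a valid parent.\<close>

lemma runs_bfs_row:
  assumes n: "m ''n'' [] = n" and A: "alive m = A" "A \<subseteq> {..<n} \<times> {..<n}"
    and l: "m ''l'' [] = l" and y: "m ''y'' [] = y"
  shows "runs r bfs_row m (bfs_row_time n) (\<lambda>m'. same bfs_keep m m' \<and> m' ''l'' = m ''l'' \<and> m' ''y'' = m ''y''
     \<and> (\<forall>i z. (i, z) \<noteq> (Suc l, y) \<longrightarrow> m' ''R'' [i, z] = m ''R'' [i, z] \<and> m' ''par'' [i, z] = m ''par'' [i, z])
     \<and> (0 < m' ''R'' [Suc l, y] \<longleftrightarrow> (\<exists>x<n. 0 < m ''R'' [l, x] \<and> (x, y) \<in> A))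
     \<and> (0 < m' ''R'' [Suc l, y] \<longrightarrow> m' ''par'' [Suc l, y] < n \<and> 0 < m ''R'' [l, m' ''par'' [Suc l, y]]
          \<and> (m' ''par'' [Suc l, y], y) \<in> A))"
  unfolding bfs_row_def bfs_row_time_def
  apply (rule runs_Seq, rule runs_assign)
  apply (rule runs_For[where n = n and I = "\<lambda>j m'. same bfs_keep m m' \<and> m' ''l'' = m ''l'' \<and> m' ''y'' = m ''y''
     \<and> (\<forall>i z. (i, z) \<noteq> (Suc l, y) \<longrightarrow> m' ''R'' [i, z] = m ''R'' [i, z] \<and> m' ''par'' [i, z] = m ''par'' [i, z])
     \<and> (0 < m' ''R'' [Suc l, y] \<longleftrightarrow> (\<exists>x<j. 0 < m ''R'' [l, x] \<and> (x, y) \<in> A))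
     \<and> (0 < m' ''R'' [Suc l, y] \<longrightarrow> m' ''par'' [Suc l, y] < n \<and> 0 < m ''R'' [l, m' ''par'' [Suc l, y]]
          \<and> (m' ''par'' [Suc l, y], y) \<in> A)"])
       apply (simp)
      apply (simp add: n store_def)
     apply (simp add: same_def store_def l y)
    apply (simp add: same_def store_def)
   apply (rule runs_Cond)
    apply (rule runs_Seq, rule runs_assign, rule runs_assign)
    apply (use A l y in \<open>auto simp: same_def store_def alive_def less_Suc_eq\<close>)[1]
   apply (rule runs_Skip)
   apply (use A l y in \<open>auto simp: same_def store_def alive_def less_Suc_eq\<close>)[1]
  apply blast
  done

text \<open>Parents are stored per length, not per vertex: a walk of exactly \<open>l\<close> edges
  may revisit vertices, and going back has to lower the length by one at every step.\<close>

definition reached ::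
    "(nat \<times> nat) set \<Rightarrow> nat \<Rightarrow> nstore \<Rightarrow> nat \<Rightarrow> nat \<Rightarrow> bool" where
  "reached A u m l y \<longleftrightarrow> (0 < m ''R'' [l, y] \<longleftrightarrow> (u, y) \<in> A ^^ l) \<and>
     (0 < l \<longrightarrow> 0 < m ''R'' [l, y] \<longrightarrow>
        (m ''par'' [l, y], y) \<in> A \<and> (u, m ''par'' [l, y]) \<in> A ^^ (l - 1))"

lemma reached_cong:
  "m' ''R'' [l, y] = m ''R'' [l, y] \<Longrightarrow> m' ''par'' [l, y] = m ''par'' [l, y] \<Longrightarrow>
    reached A u m' l y = reached A u m l y"
  by (simp add: reached_def)

lemma reached_Suc:
  assumes A: "A \<subseteq> {..<n} \<times> {..<n}" and old: "\<forall>z<n. reached A u m l z"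
    and R: "0 < m' ''R'' [Suc l, y] \<longleftrightarrow> (\<exists>x<n. 0 < m ''R'' [l, x] \<and> (x, y) \<in> A)"
    and par: "0 < m' ''R'' [Suc l, y] \<longrightarrow> m' ''par'' [Suc l, y] < n \<and> 0 < m ''R'' [l, m' ''par'' [Suc l, y]]
          \<and> (m' ''par'' [Suc l, y], y) \<in> A"
  shows "reached A u m' (Suc l) y"
proof -
  have "0 < m' ''R'' [Suc l, y] \<longleftrightarrow> (\<exists>x. (u, x) \<in> A ^^ l \<and> (x, y) \<in> A)"
    using A old unfolding R reached_def by blast
  then show ?thesis using old par unfolding reached_def by (auto simp: relcomp_unfold)
qed

lemma alive_same: "same bfs_keep m m' \<Longrightarrow> alive m' = alive m"
  by (simp add: same_def alive_def)

definition bfs_time :: "nat \<Rightarrow> nat \<Rightarrow> nat" where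
  "bfs_time n N = for_time n 1 + (1 + for_time N (for_time n (bfs_row_time n)))"

lemma runs_bfs:
  assumes n: "m ''n'' [] = n" and N: "m ''nn'' [] = N" and A: "alive m = A" "A \<subseteq> {..<n} \<times> {..<n}"
    and u: "m ''u'' [] = u" "u < n"
  shows "runs r bfs m (bfs_time n N) (\<lambda>m'. same bfs_keep m m' \<and> (\<forall>l\<le>N. \<forall>y<n. reached A u m' l y))"
  unfolding bfs_def bfs_time_def
proof (rule runs_Seq, rule runs_For[where n = n and
    I = "\<lambda>j m'. same bfs_keep m m' \<and> (\<forall>x<j. m' ''R'' [0, x] = 0)"])
  show "runs r (NAssign ''R'' [NConst 0, nvar ''x''] (NConst 0)) m' 1
      (\<lambda>m'. (same bfs_keep m m' \<and> (\<forall>x<Suc i. m' ''R'' [0, x] = 0)) \<and> m' ''x'' [] = i \<and> m' ''n'' [] = n)"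
    if "i < n" "same bfs_keep m m' \<and> (\<forall>x<i. m' ''R'' [0, x] = 0)" "m' ''x'' [] = i" "m' ''n'' [] = n" for i m'
    by (rule runs_assign) (use that in \<open>auto simp: same_def store_def less_Suc_eq\<close>)
next
  let ?J = "\<lambda>l m'. same bfs_keep m m' \<and> (\<forall>l'\<le>l. \<forall>z<n. reached A u m' l' z)"
  fix m1 assume m1: "same bfs_keep m m1 \<and> (\<forall>x<n. m1 ''R'' [0, x] = 0)"
  show "runs r (Seq (NAssign ''R'' [NConst 0, nvar ''u''] (NConst 1)) (For ''l'' ''nn'' (For ''y'' ''n'' bfs_row)))
      m1 (1 + for_time N (for_time n (bfs_row_time n)))
      (\<lambda>m'. same bfs_keep m m' \<and> (\<forall>l\<le>N. \<forall>y<n. reached A u m' l y))"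
  proof (rule runs_Seq, rule runs_assign, rule runs_For[where n = N and I = ?J])
    show "store m1 ''R'' (map (neval m1) [NConst 0, nvar ''u'']) (neval m1 (NConst 1)) ''nn'' [] = N"
      using m1 N by (simp add: same_def store_def)
    show "?J 0 (store m1 ''R'' (map (neval m1) [NConst 0, nvar ''u'']) (neval m1 (NConst 1)))"
      using m1 u by (auto simp: same_def store_def reached_def)
    show "?J l (store m' ''l'' [] a)" if "?J l m'" for l m' a
      using that by (simp add: same_def store_def reached_def)
    fix l m2 assume l: "l < N" and m2: "?J l m2" "m2 ''l'' [] = l" "m2 ''nn'' [] = N"
    show "runs r (For ''y'' ''n'' bfs_row) m2 (for_time n (bfs_row_time n))
        (\<lambda>m'. ?J (Suc l) m' \<and> m' ''l'' [] = l \<and> m' ''nn'' [] = N)"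
    proof (rule runs_For[where n = n and
        I = "\<lambda>y m'. ?J l m' \<and> m' ''l'' [] = l \<and> (\<forall>z<y. reached A u m' (Suc l) z)"])
      show "m2 ''n'' [] = n" using m2 n by (simp add: same_def)
      show "?J l (store m' ''y'' [] a) \<and> store m' ''y'' [] a ''l'' [] = l \<and> (\<forall>z<y. reached A u (store m' ''y'' [] a) (Suc l) z)"
        if "?J l m' \<and> m' ''l'' [] = l \<and> (\<forall>z<y. reached A u m' (Suc l) z)" for y m' a
        using that by (simp add: same_def store_def reached_def)
      show "?J (Suc l) m' \<and> m' ''l'' [] = l \<and> m' ''nn'' [] = N"
        if "?J l m' \<and> m' ''l'' [] = l \<and> (\<forall>z<n. reached A u m' (Suc l) z)" for m'
        using that N by (auto simp: le_Suc_eq same_def)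
      fix y m3
      assume y: "y < n" and m3: "?J l m3 \<and> m3 ''l'' [] = l \<and> (\<forall>z<y. reached A u m3 (Suc l) z)"
        "m3 ''y'' [] = y" "m3 ''n'' [] = n"
      have A3: "alive m3 = A" using m3(1) A(1) alive_same by blast
      show "runs r bfs_row m3 (bfs_row_time n) (\<lambda>m'. (?J l m' \<and> m' ''l'' [] = l \<and>
          (\<forall>z<Suc y. reached A u m' (Suc l) z)) \<and> m' ''y'' [] = y \<and> m' ''n'' [] = n)"
      proof (rule runs_conseq[OF runs_bfs_row[OF m3(3) A3 A(2) _ m3(2)] le_refl])
        show "m3 ''l'' [] = l" using m3 by simp
        fix m4
        assume m4: "same bfs_keep m3 m4 \<and> m4 ''l'' = m3 ''l'' \<and> m4 ''y'' = m3 ''y''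
          \<and> (\<forall>i z. (i, z) \<noteq> (Suc l, y) \<longrightarrow> m4 ''R'' [i, z] = m3 ''R'' [i, z] \<and> m4 ''par'' [i, z] = m3 ''par'' [i, z])
          \<and> (0 < m4 ''R'' [Suc l, y] \<longleftrightarrow> (\<exists>x<n. 0 < m3 ''R'' [l, x] \<and> (x, y) \<in> A))
          \<and> (0 < m4 ''R'' [Suc l, y] \<longrightarrow> m4 ''par'' [Suc l, y] < n \<and> 0 < m3 ''R'' [l, m4 ''par'' [Suc l, y]]
          \<and> (m4 ''par'' [Suc l, y], y) \<in> A)"
        have cell: "reached A u m4 i z = reached A u m3 i z" if "(i, z) \<noteq> (Suc l, y)" for i z
          using m4 that by (intro reached_cong) blast+
        have "same bfs_keep m m4" using m3 m4 by (simp add: same_def)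
        moreover have "\<forall>l'\<le>l. \<forall>z<n. reached A u m4 l' z" using m3 cell by auto
        moreover have "reached A u m4 (Suc l) y"
          by (rule reached_Suc[OF A(2)]) (use m3 m4 in auto)
        then have "\<forall>z<Suc y. reached A u m4 (Suc l) z" using m3 cell by (auto simp: less_Suc_eq)
        ultimately show "(?J l m4 \<and> m4 ''l'' [] = l \<and> (\<forall>z<Suc y. reached A u m4 (Suc l) z)) \<and>
            m4 ''y'' [] = y \<and> m4 ''n'' [] = n"
          using m3 m4 by (simp add: same_def)
      qed
    qed (use m2 in simp_all)
  qed simp_all
qed (simp_all add: n same_def store_def)

section \<open>Finding one short walk and marking its edges\<close>

definition search :: com where
  "search = Seq (NAssign ''hit'' [] (NConst 0))
     (For ''l'' ''nn1'' (Cond (BAnd (BNot (NLess (nvar ''kk'') (nvar ''l''))) (nz (NVar ''R'' [nvar ''l'', nvar ''v''])))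
        (NAssign ''hit'' [] (nvar ''l'')) Skip))"

definition search_time :: "nat \<Rightarrow> nat" where
  "search_time N = 1 + for_time (Suc N) (1 + 1 + 1)"

text \<open>The value 0 of \<open>hit\<close> can stand for failure since a walk between distinct
  nodes has positive length. The limit \<open>nn1\<close> is one larger than \<open>nn\<close> so
  that length \<open>N\<close> itself is examined.\<close>

lemma runs_search:
  assumes "m ''nn1'' [] = Suc N" "m ''kk'' [] = L" "m ''v'' [] = v"
  shows "runs r search m (search_time N) (\<lambda>m'. same (bfs_keep @ [''R'', ''par'']) m m' \<and>
    (0 < m' ''hit'' [] \<longrightarrow> m' ''hit'' [] \<le> N \<and> m' ''hit'' [] \<le> L \<and> 0 < m ''R'' [m' ''hit'' [], v]) \<and>
    (m' ''hit'' [] = 0 \<longrightarrow> (\<forall>l\<le>N. 0 < l \<longrightarrow> l \<le> L \<longrightarrow> m ''R'' [l, v] = 0)))"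
  unfolding search_def search_time_def
  apply (rule runs_Seq, rule runs_assign)
  apply (rule runs_For[where n = "Suc N" and I = "\<lambda>j m'. same (bfs_keep @ [''R'', ''par'']) m m' \<and>
    (0 < m' ''hit'' [] \<longrightarrow> m' ''hit'' [] \<le> N \<and> m' ''hit'' [] \<le> L \<and> 0 < m ''R'' [m' ''hit'' [], v]) \<and>
    (m' ''hit'' [] = 0 \<longrightarrow> (\<forall>l<j. 0 < l \<longrightarrow> l \<le> L \<longrightarrow> m ''R'' [l, v] = 0))"])
       apply simp
      apply (simp add: assms store_def)
     apply (simp add: same_def store_def)
    apply (simp add: same_def store_def)
   apply (rule runs_Cond)
    apply (rule runs_assign)
    apply (use assms in \<open>auto simp: same_def store_def less_Suc_eq\<close>)[1]
   apply (rule runs_Skip)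
   apply (use assms in \<open>auto simp: same_def store_def less_Suc_eq\<close>)[1]
  apply (simp add: less_Suc_eq_le)
  done

definition unwind :: com where
  "unwind = Seq (NAssign ''cnt'' [] (NAdd (nvar ''cnt'') (NConst 1))) (Seq (NAssign ''x'' [] (nvar ''v''))
     (For ''p'' ''nn'' (Cond (nz (nvar ''hit''))
        (Seq (NAssign ''y'' [] (NVar ''par'' [nvar ''hit'', nvar ''x'']))
        (Seq (NAssign ''rem'' [nvar ''it'', nvar ''x'', nvar ''y''] (NConst 1))
        (Seq (NAssign ''rem'' [nvar ''it'', nvar ''y'', nvar ''x''] (NConst 1))
        (Seq (NAssign ''x'' [] (nvar ''y''))
          (NAssign ''hit'' [] (NSub (nvar ''hit'') (NConst 1)))))))
        Skip)))"

definition unwind_time :: "nat \<Rightarrow> nat" where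
  "unwind_time N = 1 + (1 + for_time N (1 + (1 + (1 + (1 + (1 + 1)))) + 1))"

abbreviation unwind_keep :: "string list" where
  "unwind_keep \<equiv> inputs @ [''it'', ''u'', ''v'', ''q'', ''out'', ''done'']"

definition removed :: "nat \<Rightarrow> nat set set \<Rightarrow> nstore \<Rightarrow> bool" where
  "removed it F m \<longleftrightarrow> (\<forall>a b. 0 < m ''rem'' [it, a, b] \<longleftrightarrow> {a, b} \<in> F)"

text \<open>\<open>M\<close> holds the edges of the last \<open>l\<close> steps of the walk, leading
  from the current vertex \<open>x\<close> to \<open>v\<close>. Edges may repeat, hence only
  \<open>card M \<le> l\<close>.\<close>

definition traced ::
    "nat set set \<Rightarrow> nat set set \<Rightarrow> nat \<Rightarrow> nat \<Rightarrow> nat \<Rightarrow> nat \<Rightarrow> nstore \<Rightarrow> nat set set \<Rightarrow> bool" where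
  "traced X F it l x v m M \<longleftrightarrow> M \<subseteq> X \<and> finite M \<and> card M \<le> l \<and> (x, v) \<in> sym_arcs M ^^ l \<and> removed it (F \<union> M) m"

lemma traced_step:
  assumes t: "traced X F it l x v m M" and e: "{y, x} \<in> X"
    and m': "\<And>a b. m' ''rem'' [it, a, b] = (if {a, b} = {x, y} then 1 else m ''rem'' [it, a, b])"
  shows "traced X F it (Suc l) y v m' (insert {y, x} M)"
proof -
  have "card (insert {y, x} M) \<le> Suc l"
    using t by (auto simp: traced_def card_insert_if)
  moreover have "(x, v) \<in> sym_arcs (insert {y, x} M) ^^ l"
    using t relpow_monoD[OF sym_arcs_mono, of M "insert {y, x} M"] by (auto simp: traced_def)
  then have "(y, v) \<in> sym_arcs (insert {y, x} M) ^^ Suc l"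
    by (rule relpow_Suc_I2[rotated]) (simp add: sym_arcs_def)
  moreover have "removed it (F \<union> insert {y, x} M) m'"
    using t m' unfolding traced_def removed_def by (auto simp: insert_commute)
  ultimately show ?thesis using t e unfolding traced_def by simp
qed

lemma runs_unwind:
  assumes N: "m ''nn'' [] = N" and v: "m ''v'' [] = v" "v < n" and it: "m ''it'' [] = it"
    and l: "m ''hit'' [] = l" "l \<le> N" "0 < m ''R'' [l, v]"
    and X: "sym_arcs X \<subseteq> {..<n} \<times> {..<n}" and F: "removed it F m"
    and R: "\<forall>l\<le>N. \<forall>y<n. reached (sym_arcs X) u m l y"
  shows "runs r unwind m (unwind_time N) (\<lambda>m'. same unwind_keep m m' \<and>
    m' ''cnt'' [] = Suc (m ''cnt'' []) \<and>
    (\<forall>i a b. i \<noteq> it \<longrightarrow> m' ''rem'' [i, a, b] = m ''rem'' [i, a, b]) \<and>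
    (\<exists>M. traced X F it l u v m' M))"
proof -
  \<comment> \<open>Under truncated subtraction \<open>l - (l - j)\<close> is the minimum of
    \<open>l\<close> and \<open>j\<close>: the loop always runs \<open>N\<close> rounds and idles
    once \<open>hit\<close> is 0.\<close>
  let ?I = "\<lambda>j m'. same (unwind_keep @ [''R'', ''par'']) m m' \<and>
    m' ''cnt'' [] = Suc (m ''cnt'' []) \<and>
    (\<forall>i a b. i \<noteq> it \<longrightarrow> m' ''rem'' [i, a, b] = m ''rem'' [i, a, b]) \<and>
    m' ''hit'' [] = l - j \<and> m' ''x'' [] < n \<and> 0 < m ''R'' [l - j, m' ''x'' []] \<and>
    (\<exists>M. traced X F it (l - (l - j)) (m' ''x'' []) v m' M)"
  show ?thesis
    unfolding unwind_def unwind_time_def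
  proof (rule runs_Seq, rule runs_assign, rule runs_Seq, rule runs_assign, rule runs_For[where n = N and I = ?I])
    let ?m0 = "store m ''cnt'' (map (neval m) []) (neval m (NAdd (nvar ''cnt'') (NConst 1)))"
    let ?m1 = "store ?m0 ''x'' (map (neval ?m0) []) (neval ?m0 (nvar ''v''))"
    show "?m1 ''nn'' [] = N" using N by (simp add: store_def)
    have "traced X F it (l - (l - 0)) v v ?m1 {}"
      using F by (simp add: traced_def removed_def store_def)
    then show "?I 0 ?m1" using v l by (auto simp: same_def store_def)
    show "?I j (store m' ''p'' [] a)" if "?I j m'" for j m' a
      using that by (simp add: same_def store_def traced_def removed_def)
    show "same unwind_keep m m' \<and> m' ''cnt'' [] = Suc (m ''cnt'' []) \<and>
        (\<forall>i a b. i \<noteq> it \<longrightarrow> m' ''rem'' [i, a, b] = m ''rem'' [i, a, b]) \<and> (\<exists>M. traced X F it l u v m' M)"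
      if m': "?I N m'" for m'
    proof -
      \<comment> \<open>As \<open>l \<le> N\<close>, the trace has come down to length 0, where only
        \<open>u\<close> is reached.\<close>
      have "reached (sym_arcs X) u m 0 (m' ''x'' [])" using R m' by blast
      then have "m' ''x'' [] = u" using m' l by (simp add: reached_def)
      then show ?thesis using m' l by (simp add: same_def)
    qed
    fix j m' assume j: "j < N" and m': "?I j m'" "m' ''p'' [] = j" "m' ''nn'' [] = N"
    let ?x = "m' ''x'' []"
    obtain M where M: "traced X F it (l - (l - j)) ?x v m' M" using m' by blast
    show "runs r (Cond (nz (nvar ''hit''))
        (Seq (NAssign ''y'' [] (NVar ''par'' [nvar ''hit'', nvar ''x'']))
        (Seq (NAssign ''rem'' [nvar ''it'', nvar ''x'', nvar ''y''] (NConst 1))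
        (Seq (NAssign ''rem'' [nvar ''it'', nvar ''y'', nvar ''x''] (NConst 1))
        (Seq (NAssign ''x'' [] (nvar ''y''))
          (NAssign ''hit'' [] (NSub (nvar ''hit'') (NConst 1)))))))
        Skip) m' (1 + (1 + (1 + (1 + (1 + 1)))) + 1) (\<lambda>m'. ?I (Suc j) m' \<and> m' ''p'' [] = j \<and> m' ''nn'' [] = N)"
    proof (rule runs_Cond)
      assume "beval (m', r) (nz (nvar ''hit''))"
      then have h: "j < l" using m' by simp
      let ?y = "m ''par'' [l - j, ?x]"
      have "reached (sym_arcs X) u m (l - j) ?x" using R m' l by (meson diff_le_self le_trans)
      then have y: "(?y, ?x) \<in> sym_arcs X" "(u, ?y) \<in> sym_arcs X ^^ (l - Suc j)"
        using m' h by (auto simp: reached_def)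
      then have yn: "?y < n" using X by blast
      have "reached (sym_arcs X) u m (l - Suc j) ?y" using R yn l by (meson diff_le_self le_trans)
      then have Ry: "0 < m ''R'' [l - Suc j, ?y]" using y by (simp add: reached_def)
      have eqs: "m' ''it'' [] = it" "m' ''par'' = m ''par''" "m' ''hit'' [] = l - j"
        using m' it by (simp_all add: same_def)
      define m5 where "m5 = store (store (store (store (store m' ''y'' [] ?y) ''rem'' [it, ?x, ?y] 1)
        ''rem'' [it, ?y, ?x] 1) ''x'' [] ?y) ''hit'' [] (l - Suc j)"
      have "{?y, ?x} \<in> X" using y by (simp add: sym_arcs_def)
      then have "traced X F it (Suc (l - (l - j))) ?y v m5 (insert {?y, ?x} M)"
        by (rule traced_step[OF M]) (auto simp: m5_def store_def doubleton_eq_iff)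
      moreover have "Suc (l - (l - j)) = l - (l - Suc j)" using h by simp
      ultimately have "?I (Suc j) m5 \<and> m5 ''p'' [] = j \<and> m5 ''nn'' [] = N"
        using m' yn Ry by (auto simp: m5_def same_def store_def)
      then show "runs r (Seq (NAssign ''y'' [] (NVar ''par'' [nvar ''hit'', nvar ''x'']))
        (Seq (NAssign ''rem'' [nvar ''it'', nvar ''x'', nvar ''y''] (NConst 1))
        (Seq (NAssign ''rem'' [nvar ''it'', nvar ''y'', nvar ''x''] (NConst 1))
        (Seq (NAssign ''x'' [] (nvar ''y''))
          (NAssign ''hit'' [] (NSub (nvar ''hit'') (NConst 1))))))) m' (1 + (1 + (1 + (1 + 1))))
        (\<lambda>m'. ?I (Suc j) m' \<and> m' ''p'' [] = j \<and> m' ''nn'' [] = N)"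
        by (intro runs_Seq runs_assign) (simp add: eqs m5_def store_other)
    next
      assume "\<not> beval (m', r) (nz (nvar ''hit''))"
      then have "l - Suc j = l - j" using m' by simp
      then show "runs r Skip m' 1 (\<lambda>m'. ?I (Suc j) m' \<and> m' ''p'' [] = j \<and> m' ''nn'' [] = N)"
        using m' by (intro runs_Skip) simp
    qed
  qed simp
qed

section \<open>Packings of edge-disjoint short walks\<close>

inductive packing :: "nat set set \<Rightarrow> nat \<Rightarrow> nat \<Rightarrow> nat \<Rightarrow> nat \<Rightarrow> nat set set \<Rightarrow> bool" for H u v L where
  packing_empty: "packing H u v L 0 {}"
| packing_Suc: "packing H u v L c F \<Longrightarrow> M \<subseteq> H - F \<Longrightarrow> finite M \<Longrightarrow> card M \<le> L \<Longrightarrow> l \<le> L \<Longrightarrow>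
    (u, v) \<in> sym_arcs M ^^ l \<Longrightarrow> packing H u v L (Suc c) (F \<union> M)"

lemma packing_card: "packing H u v L c F \<Longrightarrow> F \<subseteq> H \<and> finite F \<and> card F \<le> c * L"
proof (induction rule: packing.induct)
  case (packing_Suc c F M l)
  then have "card (F \<union> M) \<le> Suc c * L" using card_Un_le[of F M] by simp
  then show ?case using packing_Suc by blast
qed simp

lemma relpow_sym_arcs_empty: "(u, v) \<in> sym_arcs {} ^^ l \<Longrightarrow> u = v"
  by (cases l) (auto simp: sym_arcs_def)

text \<open>Distinct ends make every walk use an edge, and the edge sets are disjoint. So a packing
  has at most \<open>card H\<close> walks, however large \<open>f\<close> is.\<close>

lemma packing_size:
  assumes "packing H u v L c F" "u \<noteq> v"
  shows "c \<le> card F"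
  using assms(1)
proof (induction rule: packing.induct)
  case (packing_Suc c F M l)
  have "M \<noteq> {}"
  proof
    assume "M = {}"
    then have "(u, v) \<in> sym_arcs {} ^^ l" using packing_Suc.hyps(6) by simp
    then show False using relpow_sym_arcs_empty assms(2) by metis
  qed
  then have "0 < card M" using packing_Suc.hyps by (simp add: card_gt_0_iff)
  moreover have "card (F \<union> M) = card F + card M"
    using packing_Suc.hyps packing_card by (intro card_Un_disjoint) auto
  ultimately show ?case using packing_Suc.IH by simp
qed simp

text \<open>If \<open>G\<close> meets the last walk, it meets the rest of the packing in fewer edges
  and the induction hypothesis applies; otherwise the last walk survives.\<close>

lemma packing_survives:
  assumes "packing H u v L c F" "finite G" "card (G \<inter> F) < c"
  shows "\<exists>l\<le>L. (u, v) \<in> sym_arcs (H - G) ^^ l"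
  using assms(1,3)
proof (induction rule: packing.induct)
  case (packing_Suc c F M l)
  show ?case
  proof (cases "G \<inter> M = {}")
    case True
    then have "M \<subseteq> H - G" using packing_Suc.hyps(2) by blast
    then show ?thesis using relpow_monoD[OF sym_arcs_mono packing_Suc.hyps(6)] packing_Suc.hyps(5) by blast
  next
    case False
    have "G \<inter> F \<subset> G \<inter> (F \<union> M)" using False packing_Suc.hyps(2) by blast
    then have "card (G \<inter> F) < card (G \<inter> (F \<union> M))" using assms(2) by (intro psubset_card_mono) auto
    then have "card (G \<inter> F) < c" using packing_Suc.prems by linarith
    then show ?thesis by (rule packing_Suc.IH)
  qed
qed simp

text \<open>The packing is not stopped after \<open>f + 1\<close> walks. The number of rounds
  depends on \<open>n\<close> only, and the result is maximal, which is what makes it a cut.\<close>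

definition pack :: com where
  "pack = For ''q'' ''nn'' (Seq bfs (Seq search (Cond (nz (nvar ''hit'')) unwind Skip)))"

definition pack_time :: "nat \<Rightarrow> nat \<Rightarrow> nat" where
  "pack_time n N = for_time N (bfs_time n N + (search_time N + (1 + unwind_time N + 1)))"

abbreviation pack_keep :: "string list" where
  "pack_keep \<equiv> inputs @ [''it'', ''u'', ''v'', ''out'', ''done'']"

definition adjacency :: "nat set set \<Rightarrow> nstore \<Rightarrow> bool" where
  "adjacency H m \<longleftrightarrow> (\<forall>a b. 0 < m ''out'' [a, b] \<longleftrightarrow> {a, b} \<in> H)"

definition separated ::
    "nat \<Rightarrow> nat \<Rightarrow> nat \<Rightarrow> nat set set \<Rightarrow> bool" where
  "separated L u v X \<longleftrightarrow> (\<forall>l\<le>L. (u, v) \<notin> sym_arcs X ^^ l)"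

lemma alive_eq: "adjacency H m \<Longrightarrow> removed (m ''it'' []) F m \<Longrightarrow> alive m = sym_arcs (H - F)"
proof -
  assume *: "adjacency H m" "removed (m ''it'' []) F m"
  then have "m ''rem'' [m ''it'' [], a, b] = 0 \<longleftrightarrow> {a, b} \<notin> F" for a b
    unfolding removed_def by (metis neq0_conv)
  then show ?thesis using *(1) by (auto simp: adjacency_def alive_def sym_arcs_def)
qed

lemma runs_pack_step:
  assumes inp: "m ''n'' [] = n" "m ''nn'' [] = N" "m ''nn1'' [] = Suc N" "m ''kk'' [] = L"
    and uv: "m ''u'' [] = u" "m ''v'' [] = v" "u < n" "v < n" "u \<noteq> v" and it: "m ''it'' [] = it"
    and H: "adjacency H m" "sym_arcs H \<subseteq> {..<n} \<times> {..<n}"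
    and F: "removed it F m" "packing H u v L (m ''cnt'' []) F"
  shows "runs r (Seq bfs (Seq search (Cond (nz (nvar ''hit'')) unwind Skip))) m
    (bfs_time n N + (search_time N + (1 + unwind_time N + 1)))
    (\<lambda>m'. same (pack_keep @ [''q'']) m m' \<and> (\<forall>i a b. i \<noteq> it \<longrightarrow> m' ''rem'' [i, a, b] = m ''rem'' [i, a, b]) \<and>
      (\<exists>F'. F \<subseteq> F' \<and> removed it F' m' \<and> packing H u v L (m' ''cnt'' []) F' \<and>
        (m' ''cnt'' [] = Suc (m ''cnt'' []) \<or>
         m' ''cnt'' [] = m ''cnt'' [] \<and> F' = F \<and> separated (min L N) u v (H - F))))"
    (is "runs r _ m _ ?Q")
proof -
  let ?A = "sym_arcs (H - F)"
  have A: "alive m = ?A" using alive_eq H(1) F(1) it by simp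
  have An: "?A \<subseteq> {..<n} \<times> {..<n}" using H(2) sym_arcs_mono[of "H - F" H] by blast
  show ?thesis
  proof (rule runs_Seq, rule runs_conseq[OF runs_bfs[where m = m, OF inp(1,2) A An uv(1,3)] le_refl])
    fix m1 assume m1: "same bfs_keep m m1 \<and> (\<forall>l\<le>N. \<forall>y<n. reached ?A u m1 l y)"
    have eq1: "m1 ''nn1'' [] = Suc N" "m1 ''kk'' [] = L" "m1 ''v'' [] = v"
      using m1 inp uv by (simp_all add: same_def)
    show "runs r (Seq search (Cond (nz (nvar ''hit'')) unwind Skip)) m1 (search_time N + (1 + unwind_time N + 1)) ?Q"
    proof (rule runs_Seq, rule runs_conseq[OF runs_search[where m = m1 and N = N and L = L and v = v,
        OF eq1] le_refl])
      fix m2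
      assume m2: "same (bfs_keep @ [''R'', ''par'']) m1 m2 \<and>
        (0 < m2 ''hit'' [] \<longrightarrow> m2 ''hit'' [] \<le> N \<and> m2 ''hit'' [] \<le> L \<and> 0 < m1 ''R'' [m2 ''hit'' [], v]) \<and>
        (m2 ''hit'' [] = 0 \<longrightarrow> (\<forall>l\<le>N. 0 < l \<longrightarrow> l \<le> L \<longrightarrow> m1 ''R'' [l, v] = 0))"
      have s2: "same bfs_keep m m2" and R2: "m2 ''R'' = m1 ''R''" "m2 ''par'' = m1 ''par''"
        using m1 m2 by (simp_all add: same_def)
      have reach2: "\<forall>l\<le>N. \<forall>y<n. reached ?A u m2 l y"
        using m1 reached_cong[of m2 _ _ m1] R2 by simp
      have eq2: "m2 ''nn'' [] = N" "m2 ''v'' [] = v" "m2 ''it'' [] = it" and cnt2: "m2 ''cnt'' = m ''cnt''"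
        and rem2: "m2 ''rem'' = m ''rem''"
        using s2 inp uv it by (simp_all add: same_def)
      have F2: "removed it F m2" using F(1) rem2 by (simp add: removed_def)
      show "runs r (Cond (nz (nvar ''hit'')) unwind Skip) m2 (1 + unwind_time N + 1) ?Q"
      proof (rule runs_Cond)
        assume "beval (m2, r) (nz (nvar ''hit''))"
        then have hit: "m2 ''hit'' [] \<le> N" "m2 ''hit'' [] \<le> L" "0 < m2 ''R'' [m2 ''hit'' [], v]"
          using m2 R2 by simp_all
        show "runs r unwind m2 (unwind_time N) ?Q"
        proof (rule runs_conseq[OF runs_unwind[where m = m2 and N = N and v = v and it = it and l = "m2 ''hit'' []",
            OF eq2(1,2) uv(4) eq2(3) refl hit(1,3) An F2 reach2] le_refl])
          fix m3
          assume m3: "same unwind_keep m2 m3 \<and> m3 ''cnt'' [] = Suc (m2 ''cnt'' []) \<and>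
            (\<forall>i a b. i \<noteq> it \<longrightarrow> m3 ''rem'' [i, a, b] = m2 ''rem'' [i, a, b]) \<and>
            (\<exists>M. traced (H - F) F it (m2 ''hit'' []) u v m3 M)"
          then obtain M where "traced (H - F) F it (m2 ''hit'' []) u v m3 M" by blast
          then have M: "M \<subseteq> H - F" "finite M" "card M \<le> m2 ''hit'' []"
            "(u, v) \<in> sym_arcs M ^^ (m2 ''hit'' [])" "removed it (F \<union> M) m3"
            unfolding traced_def by blast+
          have c: "m3 ''cnt'' [] = Suc (m ''cnt'' [])" using m3 cnt2 by simp
          have "packing H u v L (m3 ''cnt'' []) (F \<union> M)"
            unfolding c by (rule packing_Suc[OF F(2) M(1,2) _ hit(2) M(4)]) (use M(3) hit(2) in simp)
          then have "\<exists>F'. F \<subseteq> F' \<and> removed it F' m3 \<and> packing H u v L (m3 ''cnt'' []) F' \<and>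
              (m3 ''cnt'' [] = Suc (m ''cnt'' []) \<or>
               m3 ''cnt'' [] = m ''cnt'' [] \<and> F' = F \<and> separated (min L N) u v (H - F))"
            using M(5) c by (intro exI[of _ "F \<union> M"]) simp
          moreover have "same (pack_keep @ [''q'']) m m3" using s2 m3 by (simp add: same_def)
          moreover have "\<forall>i a b. i \<noteq> it \<longrightarrow> m3 ''rem'' [i, a, b] = m ''rem'' [i, a, b]"
            using m3 rem2 by simp
          ultimately show "?Q m3" by (intro conjI)
        qed
      next
        assume "\<not> beval (m2, r) (nz (nvar ''hit''))"
        then have "m2 ''hit'' [] = 0" by simp
        then have none: "\<forall>l\<le>N. 0 < l \<longrightarrow> l \<le> L \<longrightarrow> m1 ''R'' [l, v] = 0" using m2 by blast
        have "(u, v) \<notin> ?A ^^ l" if l: "l \<le> min L N" for l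
        proof (cases "l = 0")
          case True
          then show ?thesis using uv(5) by simp
        next
          case False
          have lN: "l \<le> N" using l by simp
          then have "m1 ''R'' [l, v] = 0" using none False l by simp
          moreover have "reached ?A u m1 l v" using conjunct2[OF m1] lN uv(4) by blast
          ultimately show ?thesis unfolding reached_def by (metis less_numeral_extra(3))
        qed
        then have sep: "separated (min L N) u v (H - F)" unfolding separated_def by blast
        have "same (pack_keep @ [''q'']) m m2" using s2 by (simp add: same_def)
        moreover have "\<forall>i a b. i \<noteq> it \<longrightarrow> m2 ''rem'' [i, a, b] = m ''rem'' [i, a, b]" using rem2 by simp
        moreover have "\<exists>F'. F \<subseteq> F' \<and> removed it F' m2 \<and> packing H u v L (m2 ''cnt'' []) F' \<and>
              (m2 ''cnt'' [] = Suc (m ''cnt'' []) \<or>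
               m2 ''cnt'' [] = m ''cnt'' [] \<and> F' = F \<and> separated (min L N) u v (H - F))"
          using F2 F(2) cnt2 sep by (intro exI[of _ F]) simp
        ultimately have Q: "?Q m2" by (intro conjI)
        show "runs r Skip m2 1 ?Q" by (rule runs_Skip) (rule Q)
      qed
    qed
  qed
qed

lemma runs_pack:
  assumes inp: "m ''n'' [] = n" "m ''nn'' [] = N" "m ''nn1'' [] = Suc N" "m ''kk'' [] = L"
    and uv: "m ''u'' [] = u" "m ''v'' [] = v" "u < n" "v < n" "u \<noteq> v" and it: "m ''it'' [] = it"
    and H: "adjacency H m" "sym_arcs H \<subseteq> {..<n} \<times> {..<n}" "finite H" "card H \<le> N"
    and F: "removed it {} m" "m ''cnt'' [] = 0"
  shows "runs r pack m (pack_time n N)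
    (\<lambda>m'. same pack_keep m m' \<and> (\<forall>i a b. i \<noteq> it \<longrightarrow> m' ''rem'' [i, a, b] = m ''rem'' [i, a, b]) \<and>
      (\<exists>F. packing H u v L (m' ''cnt'' []) F \<and> separated (min L N) u v (H - F)))"
proof -
  let ?I = "\<lambda>j m'. same pack_keep m m' \<and> (\<forall>i a b. i \<noteq> it \<longrightarrow> m' ''rem'' [i, a, b] = m ''rem'' [i, a, b]) \<and>
      (\<exists>F. removed it F m' \<and> packing H u v L (m' ''cnt'' []) F \<and>
        (m' ''cnt'' [] = j \<or> separated (min L N) u v (H - F)))"
  show ?thesis
    unfolding pack_def pack_time_def
  proof (rule runs_For[where n = N and I = ?I])
    show "m ''nn'' [] = N" by (rule inp)
    show "?I 0 m" using F packing_empty by (auto simp: same_def)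
    show "?I j (store m' ''q'' [] a)" if "?I j m'" for j m' a
      using that by (simp add: same_def store_other removed_def)
    show "same pack_keep m m' \<and> (\<forall>i a b. i \<noteq> it \<longrightarrow> m' ''rem'' [i, a, b] = m ''rem'' [i, a, b]) \<and>
      (\<exists>F. packing H u v L (m' ''cnt'' []) F \<and> separated (min L N) u v (H - F))" if m': "?I N m'" for m'
    proof -
      obtain F where F: "packing H u v L (m' ''cnt'' []) F" "m' ''cnt'' [] = N \<or> separated (min L N) u v (H - F)"
        using m' by blast
      have "separated (min L N) u v (H - F)" if c: "m' ''cnt'' [] = N"
      proof -
        \<comment> \<open>If every round succeeded, the packing has used up all of \<open>H\<close>,
          and the empty graph separates distinct nodes.\<close>
        have "card H \<le> card F" using packing_size[OF F(1) uv(5)] c H(4) by simp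
        then have "F = H" using packing_card[OF F(1)] H(3) by (meson card_seteq)
        then show ?thesis using relpow_sym_arcs_empty uv(5) unfolding separated_def by (metis Diff_cancel)
      qed
      then show ?thesis using F m' by blast
    qed
    fix j m' assume j: "j < N" and m': "?I j m'" "m' ''q'' [] = j" "m' ''nn'' [] = N"
    obtain F where F: "removed it F m'" "packing H u v L (m' ''cnt'' []) F"
        "m' ''cnt'' [] = j \<or> separated (min L N) u v (H - F)"
      using m' by blast
    have s: "same pack_keep m m'" using m' by blast
    have eqs: "m' ''n'' [] = n" "m' ''nn'' [] = N" "m' ''nn1'' [] = Suc N" "m' ''kk'' [] = L"
      "m' ''u'' [] = u" "m' ''v'' [] = v" "m' ''it'' [] = it" "adjacency H m'"
      using s inp uv it H(1) by (simp_all add: same_def adjacency_def)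
    show "runs r (Seq bfs (Seq search (Cond (nz (nvar ''hit'')) unwind Skip))) m'
      (bfs_time n N + (search_time N + (1 + unwind_time N + 1)))
      (\<lambda>m'. ?I (Suc j) m' \<and> m' ''q'' [] = j \<and> m' ''nn'' [] = N)"
    proof (rule runs_conseq[OF runs_pack_step[where m = m' and n = n and N = N and L = L and u = u and v = v and it = it and H = H and F = F,
            OF eqs(1-6) uv(3-5) eqs(7,8) H(2) F(1,2)] le_refl])
      fix m''
      assume m'': "same (pack_keep @ [''q'']) m' m'' \<and>
        (\<forall>i a b. i \<noteq> it \<longrightarrow> m'' ''rem'' [i, a, b] = m' ''rem'' [i, a, b]) \<and>
        (\<exists>F'. F \<subseteq> F' \<and> removed it F' m'' \<and> packing H u v L (m'' ''cnt'' []) F' \<and>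
          (m'' ''cnt'' [] = Suc (m' ''cnt'' []) \<or>
           m'' ''cnt'' [] = m' ''cnt'' [] \<and> F' = F \<and> separated (min L N) u v (H - F)))"
      then obtain F' where F': "F \<subseteq> F'" "removed it F' m''" "packing H u v L (m'' ''cnt'' []) F'"
        and c: "m'' ''cnt'' [] = Suc (m' ''cnt'' []) \<or>
           m'' ''cnt'' [] = m' ''cnt'' [] \<and> F' = F \<and> separated (min L N) u v (H - F)" by blast
      have "m'' ''cnt'' [] = Suc j \<or> separated (min L N) u v (H - F')"
      proof (cases "separated (min L N) u v (H - F)")
        case True
        \<comment> \<open>The conclusion of \<open>runs_pack_step\<close> permits a further
          increment after separation, but separation persists when \<open>F\<close> grows.\<close>
        have "H - F' \<subseteq> H - F" using F'(1) by blast
        then have "sym_arcs (H - F') \<subseteq> sym_arcs (H - F)" by (rule sym_arcs_mono)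
        then have "separated (min L N) u v (H - F')"
          using True relpow_monoD unfolding separated_def by metis
        then show ?thesis ..
      next
        case False
        then show ?thesis using F(3) c by auto
      qed
      moreover have "same pack_keep m m''" "m'' ''q'' [] = j" "m'' ''nn'' [] = N"
        using s m'' m' by (simp_all add: same_def)
      moreover have "\<forall>i a b. i \<noteq> it \<longrightarrow> m'' ''rem'' [i, a, b] = m ''rem'' [i, a, b]" using m' m'' by simp
      ultimately show "?I (Suc j) m'' \<and> m'' ''q'' [] = j \<and> m'' ''nn'' [] = N" using F' by blast
    qed
  qed simp
qed


section \<open>The greedy algorithm\<close>

text \<open>A walk can be shortened to at most as many steps as there are arcs, hence to
  \<open>n * n\<close>. Capping the length there loses nothing, while \<open>L\<close> itself may be
  exponential in the size of the input.\<close>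

lemma separated_min:
  fixes X :: "nat set set"
  assumes "sym_arcs X \<subseteq> {..<n} \<times> {..<n}" "separated (min L (n * n)) u v X"
  shows "separated L u v X"
proof -
  have "finite (sym_arcs X)" by (rule finite_subset[OF assms(1)]) simp
  moreover have "card (sym_arcs X) \<le> card ({..<n} \<times> {..<n})" using assms(1) by (intro card_mono) auto
  then have c: "card (sym_arcs X) \<le> n * n" by (simp add: card_cartesian_product)
  show ?thesis
    unfolding separated_def
  proof (intro allI impI notI)
    fix l assume l: "l \<le> L" "(u, v) \<in> sym_arcs X ^^ l"
    show False
    proof (cases "l \<le> n * n")
      case True
      then show ?thesis using assms(2) l by (simp add: separated_def)
    next
      case False
      obtain j where j: "j \<le> card (sym_arcs X)" "(u, v) \<in> sym_arcs X ^^ j"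
        using relpow_finite_bounded[OF calculation, of l] l(2) by blast
      then have "j \<le> min L (n * n)" using c False l(1) by simp
      then show ?thesis using assms(2) j(2) by (simp add: separated_def)
    qed
  qed
qed

definition process :: com where
  "process = Seq (NAssign ''done'' [nvar ''u'', nvar ''v''] (NConst 1)) (Seq (NAssign ''cnt'' [] (NConst 0))
     (Seq pack (Cond (NLess (nvar ''f'') (nvar ''cnt'')) Skip
       (Seq (NAssign ''out'' [nvar ''u'', nvar ''v''] (NConst 1)) (NAssign ''out'' [nvar ''v'', nvar ''u''] (NConst 1))))))"

definition process_time :: "nat \<Rightarrow> nat" where
  "process_time n = 1 + (1 + (pack_time n (n * n) + (1 + 1 + (1 + 1))))"

lemma runs_process:
  assumes inp: "m ''n'' [] = n" "m ''nn'' [] = n * n" "m ''nn1'' [] = Suc (n * n)" "m ''kk'' [] = L" "m ''f'' [] = f"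
    and uv: "m ''u'' [] = u" "m ''v'' [] = v" "u < n" "v < n" "u \<noteq> v" and it: "m ''it'' [] = it"
    and H: "adjacency H m" "sym_arcs H \<subseteq> {..<n} \<times> {..<n}" "finite H" "card H \<le> n * n"
    and F: "removed it {} m"
  shows "runs r process m (process_time n)
    (\<lambda>m'. same (inputs @ [''it'']) m m' \<and> (\<forall>i a b. i \<noteq> it \<longrightarrow> m' ''rem'' [i, a, b] = m ''rem'' [i, a, b]) \<and>
      m' ''done'' = (m ''done'')([u, v] := 1) \<and>
      (adjacency H m' \<and> (\<forall>G. finite G \<longrightarrow> card G \<le> f \<longrightarrow> (\<exists>l\<le>L. (u, v) \<in> sym_arcs (H - G) ^^ l)) \<or>
       adjacency (insert {u, v} H) m' \<and> (\<exists>F. finite F \<and> card F \<le> f * L \<and> separated L u v (H - F))))"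
    (is "runs r _ m _ ?Q")
  unfolding process_def process_time_def
proof (rule runs_Seq, rule runs_assign, rule runs_Seq, rule runs_assign, rule runs_Seq)
  let ?m0 = "store m ''done'' (map (neval m) [nvar ''u'', nvar ''v'']) (neval m (NConst 1))"
  define m1 where "m1 = store ?m0 ''cnt'' (map (neval ?m0) []) (neval ?m0 (NConst 0))"
  have eqs: "m1 ''n'' [] = n" "m1 ''nn'' [] = n * n" "m1 ''nn1'' [] = Suc (n * n)" "m1 ''kk'' [] = L"
      "m1 ''u'' [] = u" "m1 ''v'' [] = v" "m1 ''it'' [] = it" "adjacency H m1" "removed it {} m1" "m1 ''cnt'' [] = 0"
    using inp uv it H(1) F by (simp_all add: m1_def store_other adjacency_def removed_def)
  have m1: "same (inputs @ [''it'', ''rem'']) m m1" "m1 ''done'' = (m ''done'')([u, v] := 1)"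
    using uv by (simp_all add: m1_def same_def store_other fun_upd_def)
  have "runs r pack m1 (pack_time n (n * n)) (\<lambda>m2. runs r (Cond (NLess (nvar ''f'') (nvar ''cnt'')) Skip
       (Seq (NAssign ''out'' [nvar ''u'', nvar ''v''] (NConst 1)) (NAssign ''out'' [nvar ''v'', nvar ''u''] (NConst 1)))) m2
       (1 + 1 + (1 + 1)) ?Q)"
  proof (rule runs_conseq[OF runs_pack[where m = m1 and n = n and N = "n * n" and L = L and u = u and v = v and it = it and H = H,
          OF eqs(1-6) uv(3-5) eqs(7,8) H(2-4) eqs(9,10)] le_refl])
    fix m2
    assume m2: "same pack_keep m1 m2 \<and> (\<forall>i a b. i \<noteq> it \<longrightarrow> m2 ''rem'' [i, a, b] = m1 ''rem'' [i, a, b]) \<and>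
      (\<exists>F. packing H u v L (m2 ''cnt'' []) F \<and> separated (min L (n * n)) u v (H - F))"
    then obtain F where F: "packing H u v L (m2 ''cnt'' []) F" "separated (min L (n * n)) u v (H - F)" by blast
    have s: "same (inputs @ [''it'']) m m2" "m2 ''u'' [] = u" "m2 ''v'' [] = v" "m2 ''f'' [] = f"
      "adjacency H m2" "m2 ''done'' = (m ''done'')([u, v] := 1)"
      using m1 m2 eqs inp by (simp_all add: same_def adjacency_def)
    have rem: "\<forall>i a b. i \<noteq> it \<longrightarrow> m2 ''rem'' [i, a, b] = m ''rem'' [i, a, b]"
      using m1 m2 by (simp add: same_def)
    show "runs r (Cond (NLess (nvar ''f'') (nvar ''cnt'')) Skip
       (Seq (NAssign ''out'' [nvar ''u'', nvar ''v''] (NConst 1)) (NAssign ''out'' [nvar ''v'', nvar ''u''] (NConst 1)))) m2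
       (1 + 1 + (1 + 1)) ?Q"
    proof (rule runs_Cond)
      assume "beval (m2, r) (NLess (nvar ''f'') (nvar ''cnt''))"
      then have c: "f < m2 ''cnt'' []" using s by simp
      have "\<exists>l\<le>L. (u, v) \<in> sym_arcs (H - G) ^^ l" if G: "finite G" "card G \<le> f" for G
      proof (rule packing_survives[OF F(1) G(1)])
        show "card (G \<inter> F) < m2 ''cnt'' []"
          using card_mono[OF G(1), of "G \<inter> F"] G(2) c by simp
      qed
      then have Q: "?Q m2" using s rem by blast
      show "runs r Skip m2 1 ?Q" by (rule runs_Skip) (rule Q)
    next
      assume "\<not> beval (m2, r) (NLess (nvar ''f'') (nvar ''cnt''))"
      then have c: "m2 ''cnt'' [] \<le> f" using s by simp
      have "sym_arcs (H - F) \<subseteq> {..<n} \<times> {..<n}" using H(2) sym_arcs_mono[of "H - F" H] by blast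
      then have "separated L u v (H - F)" using F(2) by (rule separated_min)
      moreover have "card F \<le> f * L"
        using packing_card[OF F(1)] mult_le_mono1[OF c, of L] by linarith
      ultimately have cut: "\<exists>F. finite F \<and> card F \<le> f * L \<and> separated L u v (H - F)"
        using packing_card[OF F(1)] by blast
      define m3 where "m3 = store (store m2 ''out'' [u, v] 1) ''out'' [v, u] 1"
      have "adjacency (insert {u, v} H) m3"
        using s(5) by (auto simp: adjacency_def m3_def doubleton_eq_iff)
      moreover have "same (inputs @ [''it'']) m m3" "m3 ''done'' = (m ''done'')([u, v] := 1)"
        "\<forall>i a b. i \<noteq> it \<longrightarrow> m3 ''rem'' [i, a, b] = m ''rem'' [i, a, b]"
        using s rem by (simp_all add: m3_def same_def store_other fun_upd_def)
      ultimately have Q: "?Q m3" using cut by blast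
      show "runs r (Seq (NAssign ''out'' [nvar ''u'', nvar ''v''] (NConst 1)) (NAssign ''out'' [nvar ''v'', nvar ''u''] (NConst 1)))
          m2 (1 + 1) ?Q"
      proof (rule runs_Seq, rule runs_assign, rule runs_assign)
        let ?m = "store m2 ''out'' (map (neval m2) [nvar ''u'', nvar ''v'']) (neval m2 (NConst 1))"
        have eq: "store ?m ''out'' (map (neval ?m) [nvar ''v'', nvar ''u'']) (neval ?m (NConst 1)) = m3"
          using s by (simp add: m3_def store_other)
        show "?Q (store ?m ''out'' (map (neval ?m) [nvar ''v'', nvar ''u'']) (neval ?m (NConst 1)))"
          unfolding eq by (rule Q)
      qed
    qed
  qed
  then show "runs r pack (store ?m0 ''cnt'' (map (neval ?m0) []) (neval ?m0 (NConst 0))) (pack_time n (n * n))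
      (\<lambda>m2. runs r (Cond (NLess (nvar ''f'') (nvar ''cnt'')) Skip
       (Seq (NAssign ''out'' [nvar ''u'', nvar ''v''] (NConst 1)) (NAssign ''out'' [nvar ''v'', nvar ''u''] (NConst 1)))) m2
       (1 + 1 + (1 + 1)) ?Q)"
    unfolding m1_def .
qed

text \<open>Repeated selection of a minimum takes the place of sorting. The nested negations express
  the disjunction of "nothing found yet" and "lighter than the candidate"; the flag also masks
  values of \<open>u\<close> and \<open>v\<close> left from the previous round.\<close>

definition select :: com where
  "select = Seq (NAssign ''found'' [] (NConst 0)) (For ''i'' ''n'' (For ''j'' ''n''
     (Cond (BAnd (NLess (nvar ''i'') (nvar ''j'')) (BAnd (nz (NVar ''adj'' [nvar ''i'', nvar ''j'']))
         (BAnd (BNot (nz (NVar ''done'' [nvar ''i'', nvar ''j''])))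
           (BNot (BAnd (nz (nvar ''found''))
             (BNot (RLess (RVar ''w'' [nvar ''i'', nvar ''j'']) (RVar ''w'' [nvar ''u'', nvar ''v''])))))))) 
       (Seq (NAssign ''u'' [] (nvar ''i'')) (Seq (NAssign ''v'' [] (nvar ''j'')) (NAssign ''found'' [] (NConst 1))))
       Skip)))"

definition select_time :: "nat \<Rightarrow> nat" where
  "select_time n = 1 + for_time n (for_time n (1 + (1 + (1 + 1)) + 1))"

abbreviation select_keep :: "string list" where
  "select_keep \<equiv> inputs @ [''it'', ''out'', ''rem'', ''done'']"

text \<open>\<open>P\<close> describes the pairs scanned so far, in lexicographic order during the
  scan.\<close>

definition lightest ::
    "(nat set \<Rightarrow> real) \<Rightarrow> nat set set \<Rightarrow> (nat \<Rightarrow> nat \<Rightarrow> bool) \<Rightarrow> nstore \<Rightarrow> bool" where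
  "lightest w X P m \<longleftrightarrow> (if m ''found'' [] = 0 then \<forall>a b. a < b \<longrightarrow> P a b \<longrightarrow> {a, b} \<notin> X
     else m ''u'' [] < m ''v'' [] \<and> {m ''u'' [], m ''v'' []} \<in> X \<and>
       (\<forall>a b. a < b \<longrightarrow> P a b \<longrightarrow> {a, b} \<in> X \<longrightarrow> w {m ''u'' [], m ''v'' []} \<le> w {a, b}))"

lemma lightest_store:
  "x \<noteq> ''found'' \<Longrightarrow> x \<noteq> ''u'' \<Longrightarrow> x \<noteq> ''v'' \<Longrightarrow> lightest w X P (store m x js a) = lightest w X P m"
  by (simp add: lightest_def store_def)

lemma runs_select:
  assumes n: "m ''n'' [] = n" and E: "simple_graph {..<n} E"
    and adj: "\<And>a b. 0 < m ''adj'' [a, b] \<longleftrightarrow> {a, b} \<in> E"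
    and D: "\<And>a b. a < b \<Longrightarrow> 0 < m ''done'' [a, b] \<longleftrightarrow> {a, b} \<in> D"
    and w: "\<And>a b. {a, b} \<in> E \<Longrightarrow> r ''w'' [a, b] = w {a, b}"
  shows "runs r select m (select_time n) (\<lambda>m'. same select_keep m m' \<and> lightest w (E - D) (\<lambda>a b. True) m')"
  unfolding select_def select_time_def
proof (rule runs_Seq, rule runs_assign, rule runs_For[where n = n and
    I = "\<lambda>i m'. same select_keep m m' \<and> lightest w (E - D) (\<lambda>a b. a < i) m'"])
  let ?m0 = "store m ''found'' (map (neval m) []) (neval m (NConst 0))"
  show "?m0 ''n'' [] = n" using n by (simp add: store_other)
  show "same select_keep m ?m0 \<and> lightest w (E - D) (\<lambda>a b. a < 0) ?m0"
    by (simp add: same_def lightest_def store_other)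
  show "same select_keep m (store m' ''i'' [] a) \<and> lightest w (E - D) (\<lambda>a b. a < i) (store m' ''i'' [] a)"
    if "same select_keep m m' \<and> lightest w (E - D) (\<lambda>a b. a < i) m'" for i m' a
    using that by (simp add: same_def lightest_store store_other)
  show "same select_keep m m' \<and> lightest w (E - D) (\<lambda>a b. True) m'"
    if m': "same select_keep m m' \<and> lightest w (E - D) (\<lambda>a b. a < n) m'" for m'
  proof -
    have "a < n" if "{a, b} \<in> E" for a b using that E by (auto simp: simple_graph_def)
    then show ?thesis using m' by (auto simp: lightest_def split: if_splits)
  qed
  fix i m1 assume i: "i < n"
    and m1: "same select_keep m m1 \<and> lightest w (E - D) (\<lambda>a b. a < i) m1" "m1 ''i'' [] = i" "m1 ''n'' [] = n"
  let ?P = "\<lambda>j a b. a < i \<or> a = i \<and> b < j"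
  let ?I = "\<lambda>j m'. same select_keep m m' \<and> m' ''i'' [] = i \<and> lightest w (E - D) (?P j) m'"
  show "runs r (For ''j'' ''n''
     (Cond (BAnd (NLess (nvar ''i'') (nvar ''j'')) (BAnd (nz (NVar ''adj'' [nvar ''i'', nvar ''j'']))
         (BAnd (BNot (nz (NVar ''done'' [nvar ''i'', nvar ''j''])))
           (BNot (BAnd (nz (nvar ''found''))
             (BNot (RLess (RVar ''w'' [nvar ''i'', nvar ''j'']) (RVar ''w'' [nvar ''u'', nvar ''v'']))))))))
       (Seq (NAssign ''u'' [] (nvar ''i'')) (Seq (NAssign ''v'' [] (nvar ''j'')) (NAssign ''found'' [] (NConst 1))))
       Skip)) m1 (for_time n (1 + (1 + (1 + 1)) + 1))
     (\<lambda>m'. (same select_keep m m' \<and> lightest w (E - D) (\<lambda>a b. a < Suc i) m') \<and> m' ''i'' [] = i \<and> m' ''n'' [] = n)"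
  proof (rule runs_For[where n = n and I = ?I])
    show "m1 ''n'' [] = n" by (rule m1(3))
    show "?I 0 m1" using m1 by simp
    show "?I j (store m' ''j'' [] a)" if "?I j m'" for j m' a
      using that by (simp add: same_def lightest_store store_other)
    show "(same select_keep m m' \<and> lightest w (E - D) (\<lambda>a b. a < Suc i) m') \<and> m' ''i'' [] = i \<and> m' ''n'' [] = n"
      if m': "?I n m'" for m'
    proof -
      have "b < n" if "{a, b} \<in> E" for a b using that E by (auto simp: simple_graph_def)
      then have "lightest w (E - D) (\<lambda>a b. a < Suc i) m'"
        using m' by (auto simp: lightest_def less_Suc_eq split: if_splits)
      then show ?thesis using m' n by (simp add: same_def)
    qed
    fix j m2 assume j: "j < n" and m2: "?I j m2" "m2 ''j'' [] = j" "m2 ''n'' [] = n"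
    have Pj: "?P (Suc j) a b \<longleftrightarrow> ?P j a b \<or> a = i \<and> b = j" for a b by (auto simp: less_Suc_eq)
    have adj2: "0 < m2 ''adj'' [a, b] \<longleftrightarrow> {a, b} \<in> E" for a b using m2 adj by (simp add: same_def)
    have D2: "a < b \<Longrightarrow> 0 < m2 ''done'' [a, b] \<longleftrightarrow> {a, b} \<in> D" for a b using m2 D by (simp add: same_def)
    have cond: "beval (m2, r) (BAnd (NLess (nvar ''i'') (nvar ''j'')) (BAnd (nz (NVar ''adj'' [nvar ''i'', nvar ''j'']))
         (BAnd (BNot (nz (NVar ''done'' [nvar ''i'', nvar ''j''])))
           (BNot (BAnd (nz (nvar ''found''))
             (BNot (RLess (RVar ''w'' [nvar ''i'', nvar ''j'']) (RVar ''w'' [nvar ''u'', nvar ''v'']))))))))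
      \<longleftrightarrow> i < j \<and> {i, j} \<in> E - D \<and> (m2 ''found'' [] = 0 \<or> w {i, j} < w {m2 ''u'' [], m2 ''v'' []})"
      (is "?c \<longleftrightarrow> ?d")
    proof -
      have c: "?c \<longleftrightarrow> i < j \<and> {i, j} \<in> E - D \<and> (m2 ''found'' [] = 0 \<or> r ''w'' [i, j] < r ''w'' [m2 ''u'' [], m2 ''v'' []])"
        using m2 adj2[of i j] D2[of i j] by auto
      have uv: "r ''w'' [m2 ''u'' [], m2 ''v'' []] = w {m2 ''u'' [], m2 ''v'' []}" if "m2 ''found'' [] \<noteq> 0"
        using m2(1) that by (intro w) (simp add: lightest_def)
      show ?thesis
      proof (cases "m2 ''found'' [] = 0")
        case True
        then show ?thesis unfolding c by simp
      next
        case False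
        show ?thesis unfolding c uv[OF False] using w[of i j] by auto
      qed
    qed
    show "runs r (Cond (BAnd (NLess (nvar ''i'') (nvar ''j'')) (BAnd (nz (NVar ''adj'' [nvar ''i'', nvar ''j'']))
         (BAnd (BNot (nz (NVar ''done'' [nvar ''i'', nvar ''j''])))
           (BNot (BAnd (nz (nvar ''found''))
             (BNot (RLess (RVar ''w'' [nvar ''i'', nvar ''j'']) (RVar ''w'' [nvar ''u'', nvar ''v'']))))))))
       (Seq (NAssign ''u'' [] (nvar ''i'')) (Seq (NAssign ''v'' [] (nvar ''j'')) (NAssign ''found'' [] (NConst 1))))
       Skip) m2 (1 + (1 + (1 + 1)) + 1) (\<lambda>m'. ?I (Suc j) m' \<and> m' ''j'' [] = j \<and> m' ''n'' [] = n)"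
    proof (rule runs_Cond, goal_cases)
      case 1
      then have d: ?d unfolding cond .
      define m3 where "m3 = store (store (store m2 ''u'' [] i) ''v'' [] j) ''found'' [] 1"
      have "w {i, j} \<le> w {a, b}" if ab: "a < b" "?P (Suc j) a b" "{a, b} \<in> E - D" for a b
      proof (cases "a = i \<and> b = j")
        case False
        then have P: "?P j a b" using ab(2) Pj by blast
        have L: "lightest w (E - D) (?P j) m2" using m2(1) by blast
        then have nz: "m2 ''found'' [] \<noteq> 0" using P ab unfolding lightest_def by metis
        then have "w {m2 ''u'' [], m2 ''v'' []} \<le> w {a, b}" using L P ab unfolding lightest_def by metis
        then show ?thesis using d nz by linarith
      qed simp
      then have "lightest w (E - D) (?P (Suc j)) m3"
        using d by (simp add: lightest_def m3_def store_other)
      then have "?I (Suc j) m3 \<and> m3 ''j'' [] = j \<and> m3 ''n'' [] = n"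
        using m2 by (simp add: same_def m3_def store_other)
      then show ?case
        by (intro runs_Seq runs_assign) (use m2 in \<open>simp add: m3_def store_other\<close>)
    next
      case 2
      then have d: "\<not> ?d" unfolding cond .
      have L: "lightest w (E - D) (?P j) m2" using m2(1) by blast
      have "lightest w (E - D) (?P (Suc j)) m2"
      proof (cases "m2 ''found'' [] = 0")
        case True
        then show ?thesis using L d unfolding lightest_def Pj by auto
      next
        case False
        then have "i < j \<Longrightarrow> {i, j} \<in> E - D \<Longrightarrow> w {m2 ''u'' [], m2 ''v'' []} \<le> w {i, j}" using d by auto
        then show ?thesis using L False unfolding lightest_def Pj by auto
      qed
      then have Q: "?I (Suc j) m2 \<and> m2 ''j'' [] = j \<and> m2 ''n'' [] = n" using m2 by blast
      show ?case by (rule runs_Skip) (rule Q)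
    qed
  qed simp
qed simp

section \<open>The greedy invariant\<close>

definition greedy ::
    "(nat set \<Rightarrow> real) \<Rightarrow> nat set set \<Rightarrow> nat \<Rightarrow> nat \<Rightarrow> nat set set \<Rightarrow> nat set set \<Rightarrow> bool" where
  "greedy w E L f D H \<longleftrightarrow> H \<subseteq> D \<and> D \<subseteq> E \<and> (\<forall>e\<in>D. \<forall>e'\<in>E - D. w e \<le> w e') \<and>
     (\<forall>u v G. {u, v} \<in> D - H \<longrightarrow> finite G \<longrightarrow> card G \<le> f \<longrightarrow>
        (\<exists>l\<le>L. (u, v) \<in> sym_arcs ({h \<in> H. w h \<le> w {u, v}} - G) ^^ l)) \<and>
     (\<exists>es. set es = H \<and> blocked_order (L * f) L es)"

lemma greedy_empty: "greedy w E L f {} {}"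
  by (auto simp: greedy_def blocked_order_def intro!: exI[of _ "[]"])

lemma greedy_bypass:
  assumes "greedy w E L f D H" "{u, v} \<in> D - H" "finite G" "card G \<le> f"
  shows "\<exists>l\<le>L. (u, v) \<in> sym_arcs ({h \<in> H. w h \<le> w {u, v}} - G) ^^ l"
proof -
  have "\<forall>u v G. {u, v} \<in> D - H \<longrightarrow> finite G \<longrightarrow> card G \<le> f \<longrightarrow>
      (\<exists>l\<le>L. (u, v) \<in> sym_arcs ({h \<in> H. w h \<le> w {u, v}} - G) ^^ l)"
    using assms(1) unfolding greedy_def by (elim conjE)
  then show ?thesis using assms(2-4) by (elim allE impE)
qed

text \<open>Edges are processed by increasing length, so at this moment all of \<open>H\<close> is
  no heavier than the skipped edge. The invariant records this restriction because the stretch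
  argument needs light detours, and later additions to \<open>H\<close> cannot spoil it.\<close>

lemma greedy_skip:
  assumes g: "greedy w E L f D H" and e: "{u, v} \<in> E - D" "\<And>e'. e' \<in> E - D \<Longrightarrow> w {u, v} \<le> w e'"
    and bypass: "\<And>G. finite G \<Longrightarrow> card G \<le> f \<Longrightarrow> \<exists>l\<le>L. (u, v) \<in> sym_arcs (H - G) ^^ l"
  shows "greedy w E L f (insert {u, v} D) H"
  unfolding greedy_def
proof (intro conjI allI impI)
  have old: "H \<subseteq> D" "D \<subseteq> E" "\<forall>e\<in>D. \<forall>e'\<in>E - D. w e \<le> w e'" "\<exists>es. set es = H \<and> blocked_order (L * f) L es"
    using g unfolding greedy_def by blast+
  then show "H \<subseteq> insert {u, v} D" "insert {u, v} D \<subseteq> E"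
    "\<forall>e\<in>insert {u, v} D. \<forall>e'\<in>E - insert {u, v} D. w e \<le> w e'" "\<exists>es. set es = H \<and> blocked_order (L * f) L es"
    using e by blast+
  fix a b :: nat and G :: "nat set set"
  assume ab: "{a, b} \<in> insert {u, v} D - H" and G: "finite G" "card G \<le> f"
  show "\<exists>l\<le>L. (a, b) \<in> sym_arcs ({h \<in> H. w h \<le> w {a, b}} - G) ^^ l"
  proof (cases "{a, b} \<in> D")
    case True
    then have "{a, b} \<in> D - H" using ab by simp
    then show ?thesis using greedy_bypass[OF g _ G] by simp
  next
    case False
    then have eq: "{a, b} = {u, v}" using ab by blast
    have "{h \<in> H. w h \<le> w {a, b}} = H" unfolding eq using old e(1) by blast
    moreover obtain l where l: "l \<le> L" "(u, v) \<in> sym_arcs (H - G) ^^ l" using bypass[OF G] by blast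
    moreover have "(a, b) \<in> sym_arcs (H - G) ^^ l"
      using eq l(2) relpow_sym_arcs_sym[OF l(2)] by (auto simp: doubleton_eq_iff)
    ultimately show ?thesis by metis
  qed
qed

lemma blocked_order_snoc:
  assumes es: "blocked_order g L es" and e: "{u, v} \<notin> set es"
    and F: "finite F" "card F \<le> g" "separated L u v (set es - F)"
  shows "blocked_order g L (es @ [{u, v}])"
  unfolding blocked_order_def
proof (intro conjI allI impI)
  show "distinct (es @ [{u, v}])" using es e by (simp add: blocked_order_def)
  fix i assume i: "i < length (es @ [{u, v}])"
  show "\<exists>F. finite F \<and> card F \<le> g \<and> (\<forall>a b l. (es @ [{u, v}]) ! i = {a, b} \<longrightarrow> l \<le> L \<longrightarrow>
      (a, b) \<notin> sym_arcs (set (take i (es @ [{u, v}])) - F) ^^ l)"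
  proof (cases "i < length es")
    case True
    then show ?thesis using es unfolding blocked_order_def by (simp add: nth_append)
  next
    case False
    then have i: "i = length es" using i by simp
    have "(a, b) \<notin> sym_arcs (set es - F) ^^ l" if "{u, v} = {a, b}" "l \<le> L" for a b l
    proof
      assume w: "(a, b) \<in> sym_arcs (set es - F) ^^ l"
      then have "(u, v) \<in> sym_arcs (set es - F) ^^ l"
        using that(1) relpow_sym_arcs_sym[OF w] by (auto simp: doubleton_eq_iff)
      then show False using F(3) that(2) unfolding separated_def by blast
    qed
    then show ?thesis using F(1,2) i by (intro exI[of _ F]) simp
  qed
qed

lemma greedy_add:
  assumes g: "greedy w E L f D H" and e: "{u, v} \<in> E - D" "\<And>e'. e' \<in> E - D \<Longrightarrow> w {u, v} \<le> w e'"
    and F: "finite F" "card F \<le> f * L" "separated L u v (H - F)"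
  shows "greedy w E L f (insert {u, v} D) (insert {u, v} H)"
  unfolding greedy_def
proof (intro conjI allI impI)
  have old: "H \<subseteq> D" "D \<subseteq> E" "\<forall>e\<in>D. \<forall>e'\<in>E - D. w e \<le> w e'"
    using g unfolding greedy_def by blast+
  then show "insert {u, v} H \<subseteq> insert {u, v} D" "insert {u, v} D \<subseteq> E"
    "\<forall>e\<in>insert {u, v} D. \<forall>e'\<in>E - insert {u, v} D. w e \<le> w e'"
    using e by blast+
  obtain es where es: "set es = H" "blocked_order (L * f) L es" using g unfolding greedy_def by blast
  have "blocked_order (L * f) L (es @ [{u, v}])"
    by (rule blocked_order_snoc[OF es(2) _ F(1)]) (use F old e(1) es(1) in \<open>auto simp: mult.commute\<close>)
  then show "\<exists>es. set es = insert {u, v} H \<and> blocked_order (L * f) L es"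
    using es(1) by (intro exI[of _ "es @ [{u, v}]"]) simp
  fix a b :: nat and G :: "nat set set"
  assume ab: "{a, b} \<in> insert {u, v} D - insert {u, v} H" and G: "finite G" "card G \<le> f"
  then have "{a, b} \<in> D - H" by simp
  then obtain l where l: "l \<le> L" "(a, b) \<in> sym_arcs ({h \<in> H. w h \<le> w {a, b}} - G) ^^ l"
    using greedy_bypass[OF g _ G] by blast
  have "{h \<in> H. w h \<le> w {a, b}} - G \<subseteq> {h \<in> insert {u, v} H. w h \<le> w {a, b}} - G" by blast
  from relpow_monoD[OF sym_arcs_mono[OF this] l(2)]
  show "\<exists>l\<le>L. (a, b) \<in> sym_arcs ({h \<in> insert {u, v} H. w h \<le> w {a, b}} - G) ^^ l" using l(1) by metis
qed

section \<open>Initialization and main loop\<close>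

definition init :: com where
  "init = Seq (NAssign ''nn'' [] (NConst 0)) (Seq (For ''i'' ''n'' (NAssign ''nn'' [] (NAdd (nvar ''nn'') (nvar ''n''))))
     (Seq (NAssign ''nn1'' [] (NAdd (nvar ''nn'') (NConst 1)))
       (NAssign ''kk'' [] (NSub (NAdd (nvar ''k'') (nvar ''k'')) (NConst 1)))))"

definition init_time :: "nat \<Rightarrow> nat" where
  "init_time n = 1 + (for_time n 1 + (1 + 1))"

text \<open>The machine has no multiplication: \<open>n * n\<close> is accumulated by
  \<open>n\<close> additions, and \<open>2 * k - 1\<close> takes one doubling and one subtraction,
  independently of the size of \<open>k\<close>.\<close>

lemma runs_init:
  assumes n: "m ''n'' [] = n" and k: "m ''k'' [] = k"
  shows "runs r init m (init_time n) (\<lambda>m'. same [''n'', ''f'', ''k'', ''adj'', ''out'', ''rem'', ''done''] m m' \<and>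
    m' ''nn'' [] = n * n \<and> m' ''nn1'' [] = Suc (n * n) \<and> m' ''kk'' [] = 2 * k - 1)"
    (is "runs r _ m _ ?Q")
  unfolding init_def init_time_def
proof (rule runs_Seq, rule runs_assign, rule runs_Seq, rule runs_For[where n = n and
    I = "\<lambda>i m'. same [''n'', ''f'', ''k'', ''adj'', ''out'', ''rem'', ''done''] m m' \<and> m' ''nn'' [] = i * n"])
  let ?K = "[''n'', ''f'', ''k'', ''adj'', ''out'', ''rem'', ''done'']"
  let ?m0 = "store m ''nn'' (map (neval m) []) (neval m (NConst 0))"
  show "?m0 ''n'' [] = n" using n by (simp add: store_other)
  show "same ?K m ?m0 \<and> ?m0 ''nn'' [] = 0 * n" by (simp add: same_def store_other)
  show "same ?K m (store m' ''i'' [] a) \<and> store m' ''i'' [] a ''nn'' [] = i * n"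
    if "same ?K m m' \<and> m' ''nn'' [] = i * n" for i m' a
    using that by (simp add: same_def store_other)
  show "runs r (NAssign ''nn'' [] (NAdd (nvar ''nn'') (nvar ''n''))) m' 1
      (\<lambda>m'. (same ?K m m' \<and> m' ''nn'' [] = Suc i * n) \<and> m' ''i'' [] = i \<and> m' ''n'' [] = n)"
    if "same ?K m m' \<and> m' ''nn'' [] = i * n" "m' ''i'' [] = i" "m' ''n'' [] = n" for i m'
    by (rule runs_assign) (use that in \<open>simp add: same_def store_other\<close>)
  show "runs r (Seq (NAssign ''nn1'' [] (NAdd (nvar ''nn'') (NConst 1)))
       (NAssign ''kk'' [] (NSub (NAdd (nvar ''k'') (nvar ''k'')) (NConst 1)))) m' (1 + 1) ?Q"
    if "same ?K m m' \<and> m' ''nn'' [] = n * n" for m'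
    by (rule runs_Seq, rule runs_assign, rule runs_assign)
      (use that k in \<open>simp add: same_def store_other\<close>)
qed simp

definition spanner_program :: com where
  "spanner_program = Seq init (For ''it'' ''nn'' (Seq select (Cond (nz (nvar ''found'')) process Skip)))"

definition spanner_time :: "nat \<Rightarrow> nat" where
  "spanner_time n = init_time n + for_time (n * n) (select_time n + (1 + process_time n + 1))"

text \<open>\<open>done\<close> is constrained for \<open>a < b\<close> only, the pairs that
  \<open>select\<close> looks at. The last conjunct keeps the slices of \<open>rem\<close> for the
  coming rounds blank, so round \<open>j\<close> starts with an empty packing.\<close>

definition encodes ::
    "nat set set \<Rightarrow> nat set set \<Rightarrow> nat \<Rightarrow> nstore \<Rightarrow> bool" where
  "encodes D H j m \<longleftrightarrow> (\<forall>a b. a < b \<longrightarrow> (0 < m ''done'' [a, b] \<longleftrightarrow> {a, b} \<in> D)) \<and> adjacency H m \<and>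
     (\<forall>i a b. j \<le> i \<longrightarrow> m ''rem'' [i, a, b] = 0)"

lemma encodes_store:
  "x \<noteq> ''done'' \<Longrightarrow> x \<noteq> ''out'' \<Longrightarrow> x \<noteq> ''rem'' \<Longrightarrow> encodes D H j (store m x js a) = encodes D H j m"
  by (simp add: encodes_def adjacency_def store_def)

lemma edge_ordered:
  fixes e :: "nat set"
  assumes "simple_graph V E" "e \<in> E"
  shows "\<exists>a b. a < b \<and> e = {a, b}"
proof -
  have "card e = 2" using assms by (auto simp: simple_graph_def)
  then obtain a b where ab: "e = {a, b}" "a \<noteq> b" by (meson card_2_iff)
  then consider "a < b" | "b < a" by linarith
  then show ?thesis using ab(1) by cases (blast, metis insert_commute)
qed

lemma card_simple_graph_le:
  assumes "simple_graph {..<n} E"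
  shows "finite E" "card E \<le> n * n"
proof -
  have sub: "E \<subseteq> (\<lambda>(a, b). {a, b}) ` ({..<n} \<times> {..<n})"
  proof
    fix e assume e: "e \<in> E"
    then have "card e = 2" "e \<subseteq> {..<n}" using assms by (auto simp: simple_graph_def)
    then obtain a b where "e = {a, b}" "a < n" "b < n" by (auto simp: card_2_iff)
    then show "e \<in> (\<lambda>(a, b). {a, b}) ` ({..<n} \<times> {..<n})" by auto
  qed
  then show "finite E" by (rule finite_subset) simp
  have "card E \<le> card ({..<n} \<times> {..<n})" using sub by (rule surj_card_le[rotated]) simp
  then show "card E \<le> n * n" by (simp add: card_cartesian_product)
qed

text \<open>Progress is the disjunction \<open>D = E \<or> j \<le> card D\<close>: a round processes
  a new edge or finds that none is left.\<close>

lemma runs_spanner_step: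
  assumes inp: "m ''n'' [] = n" "m ''nn'' [] = n * n" "m ''nn1'' [] = Suc (n * n)" "m ''kk'' [] = L" "m ''f'' [] = f"
    and E: "simple_graph {..<n} E" and adj: "\<And>a b. 0 < m ''adj'' [a, b] \<longleftrightarrow> {a, b} \<in> E"
    and w: "\<And>a b. {a, b} \<in> E \<Longrightarrow> r ''w'' [a, b] = w {a, b}"
    and g: "greedy w E L f D H" and enc: "encodes D H j m" and it: "m ''it'' [] = j"
    and D: "D = E \<or> j \<le> card D"
  shows "runs r (Seq select (Cond (nz (nvar ''found'')) process Skip)) m (select_time n + (1 + process_time n + 1))
    (\<lambda>m'. same (inputs @ [''it'']) m m' \<and>
      (\<exists>D H. greedy w E L f D H \<and> encodes D H (Suc j) m' \<and> (D = E \<or> Suc j \<le> card D)))"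
    (is "runs r _ m _ ?Q")
proof -
  have HD: "H \<subseteq> D" "D \<subseteq> E" using g unfolding greedy_def by blast+
  have done_iff: "0 < m ''done'' [a, b] \<longleftrightarrow> {a, b} \<in> D" if "a < b" for a b
    using enc that unfolding encodes_def by blast
  have finE: "finite E" "card E \<le> n * n" using card_simple_graph_le[OF E] .
  show ?thesis
  proof (rule runs_Seq, rule runs_conseq[OF runs_select[where m = m and n = n and E = E and D = D and w = w and r = r,
          OF inp(1) E adj done_iff w] le_refl])
    fix m1 assume m1: "same select_keep m m1 \<and> lightest w (E - D) (\<lambda>a b. True) m1"
    have s1: "same (inputs @ [''it'', ''out'', ''rem'', ''done'']) m m1" using m1 by (simp add: same_def)
    have enc1: "encodes D H j m1" using s1 enc by (simp add: encodes_def adjacency_def same_def)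
    note cover = edge_ordered[OF E]
    show "runs r (Cond (nz (nvar ''found'')) process Skip) m1 (1 + process_time n + 1) ?Q"
    proof (rule runs_Cond)
      assume "\<not> beval (m1, r) (nz (nvar ''found''))"
      then have "m1 ''found'' [] = 0" by simp
      then have "\<forall>a b. a < b \<longrightarrow> {a, b} \<notin> E - D" using m1 by (simp add: lightest_def)
      then have "E - D = {}" using cover by blast
      then have "D = E" using HD by blast
      moreover have "encodes D H (Suc j) m1" using enc1 by (simp add: encodes_def)
      moreover have "same (inputs @ [''it'']) m m1" using s1 by (simp add: same_def)
      ultimately have Q: "?Q m1" using g by blast
      show "runs r Skip m1 1 ?Q" by (rule runs_Skip) (rule Q)
    next
      assume "beval (m1, r) (nz (nvar ''found''))"
      then have found: "m1 ''found'' [] \<noteq> 0" by simp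
      define u v where "u = m1 ''u'' []" and "v = m1 ''v'' []"
      have uv: "u < v" "{u, v} \<in> E - D" "\<And>a b. a < b \<Longrightarrow> {a, b} \<in> E - D \<Longrightarrow> w {u, v} \<le> w {a, b}"
        using m1 found unfolding lightest_def u_def v_def by auto
      have min: "w {u, v} \<le> w e'" if "e' \<in> E - D" for e'
        using cover[of e'] that uv(3) by blast
      have uvn: "u < n" "v < n" using uv(2) E by (auto simp: simple_graph_def)
      have eqs: "m1 ''n'' [] = n" "m1 ''nn'' [] = n * n" "m1 ''nn1'' [] = Suc (n * n)" "m1 ''kk'' [] = L" "m1 ''f'' [] = f"
        "m1 ''it'' [] = j" using s1 inp it by (simp_all add: same_def)
      have adjH: "adjacency H m1" "removed j {} m1" using enc1 by (simp_all add: encodes_def removed_def)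
      have Hn: "sym_arcs H \<subseteq> {..<n} \<times> {..<n}"
        using HD E unfolding sym_arcs_def simple_graph_def by blast
      have HE: "H \<subseteq> E" using HD by blast
      then have finH: "finite H" using finE(1) by (rule finite_subset)
      have cardH: "card H \<le> n * n" using card_mono[OF finE(1) HE] finE(2) by (rule le_trans)
      show "runs r process m1 (process_time n) ?Q"
      proof (rule runs_conseq[OF runs_process[where m = m1 and n = n and L = L and f = f and u = u and v = v and it = j and H = H,
              OF eqs(1-5) u_def[symmetric] v_def[symmetric] uvn _ eqs(6) adjH(1) Hn finH cardH adjH(2)] le_refl])
        show "u \<noteq> v" using uv(1) by simp
        fix m2
        assume m2: "same (inputs @ [''it'']) m1 m2 \<and> (\<forall>i a b. i \<noteq> j \<longrightarrow> m2 ''rem'' [i, a, b] = m1 ''rem'' [i, a, b]) \<and>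
          m2 ''done'' = (m1 ''done'')([u, v] := 1) \<and>
          (adjacency H m2 \<and> (\<forall>G. finite G \<longrightarrow> card G \<le> f \<longrightarrow> (\<exists>l\<le>L. (u, v) \<in> sym_arcs (H - G) ^^ l)) \<or>
           adjacency (insert {u, v} H) m2 \<and> (\<exists>F. finite F \<and> card F \<le> f * L \<and> separated L u v (H - F)))"
        let ?D = "insert {u, v} D"
        have "0 < m2 ''done'' [a, b] \<longleftrightarrow> {a, b} \<in> ?D" if "a < b" for a b
          using that uv(1) enc1 m2 by (auto simp: encodes_def doubleton_eq_iff)
        moreover have "m2 ''rem'' [i, a, b] = 0" if "Suc j \<le> i" for i a b
          using that m2 enc1 by (simp add: encodes_def)
        ultimately have enc2: "encodes ?D H' (Suc j) m2" if "adjacency H' m2" for H'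
          using that by (simp add: encodes_def)
        have "\<exists>H'. greedy w E L f ?D H' \<and> adjacency H' m2"
          using m2 greedy_skip[OF g uv(2) min] greedy_add[OF g uv(2) min] by blast
        then obtain H' where H': "greedy w E L f ?D H'" "encodes ?D H' (Suc j) m2" using enc2 by blast
        have "finite D" using HD finE(1) by (meson finite_subset)
        then have "card ?D = Suc (card D)" using uv(2) by simp
        moreover have "j \<le> card D" using D uv(2) by blast
        ultimately have "Suc j \<le> card ?D" by simp
        moreover have "same (inputs @ [''it'']) m m2" using s1 m2 by (simp add: same_def)
        ultimately show "?Q m2" using H' by blast
      qed
    qed
  qed
qed

lemma runs_spanner_program:
  assumes inp: "m ''n'' [] = n" "m ''k'' [] = k" "m ''f'' [] = f"
    and zero: "\<And>js. m ''done'' js = 0" "\<And>js. m ''out'' js = 0" "\<And>js. m ''rem'' js = 0"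
    and E: "simple_graph {..<n} E" and adj: "\<And>a b. 0 < m ''adj'' [a, b] \<longleftrightarrow> {a, b} \<in> E"
    and w: "\<And>a b. {a, b} \<in> E \<Longrightarrow> r ''w'' [a, b] = w {a, b}"
  shows "runs r spanner_program m (spanner_time n)
    (\<lambda>m'. \<exists>H. greedy w E (2 * k - 1) f E H \<and> adjacency H m')"
  unfolding spanner_program_def spanner_time_def
proof (rule runs_Seq, rule runs_conseq[OF runs_init[where m = m, OF inp(1,2)] le_refl])
  fix m1
  assume m1: "same [''n'', ''f'', ''k'', ''adj'', ''out'', ''rem'', ''done''] m m1 \<and>
    m1 ''nn'' [] = n * n \<and> m1 ''nn1'' [] = Suc (n * n) \<and> m1 ''kk'' [] = 2 * k - 1"
  let ?I = "\<lambda>j m'. same inputs m1 m' \<and>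
      (\<exists>D H. greedy w E (2 * k - 1) f D H \<and> encodes D H j m' \<and> (D = E \<or> j \<le> card D))"
  show "runs r (For ''it'' ''nn'' (Seq select (Cond (nz (nvar ''found'')) process Skip))) m1
      (for_time (n * n) (select_time n + (1 + process_time n + 1)))
      (\<lambda>m'. \<exists>H. greedy w E (2 * k - 1) f E H \<and> adjacency H m')"
  proof (rule runs_For[where n = "n * n" and I = ?I])
    show "m1 ''nn'' [] = n * n" using m1 by blast
    have "encodes {} {} 0 m1" using m1 zero by (simp add: encodes_def adjacency_def same_def)
    then show "?I 0 m1" using greedy_empty[of w E "2 * k - 1" f] by (intro conjI) (simp add: same_def, blast)
    show "?I j (store m' ''it'' [] a)" if "?I j m'" for j m' a
      using that by (simp add: same_def encodes_store store_other)
    show "\<exists>H. greedy w E (2 * k - 1) f E H \<and> adjacency H m'" if "?I (n * n) m'" for m'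
    proof -
      from that obtain D H where D: "greedy w E (2 * k - 1) f D H" "encodes D H (n * n) m'" "D = E \<or> n * n \<le> card D"
        by blast
      \<comment> \<open>After \<open>n * n \<ge> card E\<close> rounds both alternatives of the
        progress condition say \<open>D = E\<close>.\<close>
      have "D \<subseteq> E" using D(1) unfolding greedy_def by blast
      then have "D = E" using D(3) card_simple_graph_le[OF E] by (meson card_seteq le_trans)
      then show ?thesis using D by (auto simp: encodes_def)
    qed
    fix j m2 assume m2: "?I j m2" "m2 ''it'' [] = j" "m2 ''nn'' [] = n * n"
    then obtain D H where D: "greedy w E (2 * k - 1) f D H" "encodes D H j m2" "D = E \<or> j \<le> card D" by blast
    have eqs: "m2 ''n'' [] = n" "m2 ''nn'' [] = n * n" "m2 ''nn1'' [] = Suc (n * n)" "m2 ''kk'' [] = 2 * k - 1" "m2 ''f'' [] = f"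
      using m1 m2 inp by (simp_all add: same_def)
    have adj2: "0 < m2 ''adj'' [a, b] \<longleftrightarrow> {a, b} \<in> E" for a b using m1 m2 adj by (simp add: same_def)
    show "runs r (Seq select (Cond (nz (nvar ''found'')) process Skip)) m2 (select_time n + (1 + process_time n + 1))
        (\<lambda>m'. ?I (Suc j) m' \<and> m' ''it'' [] = j \<and> m' ''nn'' [] = n * n)"
    proof (rule runs_conseq[OF runs_spanner_step[where m = m2 and n = n and L = "2 * k - 1" and f = f and E = E and w = w
          and D = D and H = H and j = j and r = r, OF eqs E adj2 w D(1,2) m2(2) D(3)] le_refl])
      fix m3
      assume m3: "same (inputs @ [''it'']) m2 m3 \<and> (\<exists>D H. greedy w E (2 * k - 1) f D H \<and>
        encodes D H (Suc j) m3 \<and> (D = E \<or> Suc j \<le> card D))"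
      have "same inputs m1 m3" "m3 ''it'' [] = j" "m3 ''nn'' [] = n * n" using m2 m3 by (simp_all add: same_def)
      then show "?I (Suc j) m3 \<and> m3 ''it'' [] = j \<and> m3 ''nn'' [] = n * n" using m3 by blast
    qed
  qed simp
qed

section \<open>Polynomial running time and conclusion\<close>

definition polynomial :: "(nat \<Rightarrow> nat) \<Rightarrow> bool" where
  "polynomial T \<longleftrightarrow> (\<exists>p::nat poly. \<forall>n. T n = poly p n)"

lemma polynomial_const: "polynomial (\<lambda>n. c)"
  unfolding polynomial_def by (intro exI[of _ "[:c:]"]) simp

lemma polynomial_id: "polynomial (\<lambda>n. n)"
  unfolding polynomial_def by (intro exI[of _ "[:0, 1:]"]) simp

lemma polynomial_add: "polynomial S \<Longrightarrow> polynomial T \<Longrightarrow> polynomial (\<lambda>n. S n + T n)"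
  unfolding polynomial_def by (metis poly_add)

lemma polynomial_mult: "polynomial S \<Longrightarrow> polynomial T \<Longrightarrow> polynomial (\<lambda>n. S n * T n)"
  unfolding polynomial_def by (metis poly_mult)

lemma polynomial_spanner_time: "polynomial spanner_time"
proof -
  have "polynomial (\<lambda>n. spanner_time n)"
    unfolding spanner_time_def init_time_def select_time_def process_time_def pack_time_def bfs_time_def
      search_time_def unwind_time_def bfs_row_time_def for_time_def Suc_eq_plus1
    by (intro polynomial_add polynomial_mult polynomial_const polynomial_id)
  then show ?thesis by simp
qed

text \<open>Natural coefficients make the polynomial monotone, which carries a time bound in
  \<open>n\<close> over to the input size.\<close>

lemma poly_nat_mono:
  fixes p :: "nat poly"
  assumes "x \<le> y"
  shows "poly p x \<le> poly p y"
  by (induction p) (auto intro!: add_mono mult_mono assms)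

theorem theorem1p6:
  shows "\<exists>(C::real) (P::com) (p::nat poly). C > 0 \<and>
    (\<forall>(f::nat) (k::nat) (n::nat) (E::nat set set) (w::nat set \<Rightarrow> real).
       f \<ge> 1 \<and> k \<ge> 1 \<and> simple_graph {..<n} E \<and> (\<forall>e\<in>E. w e \<ge> 0) \<longrightarrow>
       (\<exists>t s. exec P (input_state f k n E w) t s \<and>
          t \<le> poly p (input_size f k n E) \<and>
          eft_spanner f (2 * real k - 1) {..<n} E w (output_edges n s) \<and>
          real (card (output_edges n s)) \<le>
            (if odd k
             then C * (real k powr (5/2) * real f powr (1/2 - 1 / (2 * real k))
                         * real n powr (1 + 1 / real k)
                       + real k ^ 2 * real f * real n)
             else C * (real k powr (5/2) * real f powr (1/2)
                         * real n powr (1 + 1 / real k)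
                       + real k ^ 2 * real f * real n))))"
proof -
  obtain p where p: "\<And>n. spanner_time n = poly p n"
    using polynomial_spanner_time unfolding polynomial_def by blast
  show ?thesis
  \<comment> \<open>The constant is that of \<open>blocked_order_bound\<close>, and the polynomial
    is the one that equals \<open>spanner_time\<close>.\<close>
  proof (rule exI[of _ 128], rule exI[of _ spanner_program], rule exI[of _ p], intro conjI allI impI, goal_cases)
    case (2 f k n E w)
    then have f: "1 \<le> f" and k: "1 \<le> k" and E: "simple_graph {..<n} E" and w: "\<And>e. e \<in> E \<Longrightarrow> 0 \<le> w e" by auto
    obtain m r where mr: "input_state f k n E w = (m, r)" by (cases "input_state f k n E w")
    have m: "m = fst (input_state f k n E w)" and r: "r = snd (input_state f k n E w)" by (simp_all add: mr)
    have "runs r spanner_program m (spanner_time n) (\<lambda>m'. \<exists>H. greedy w E (2 * k - 1) f E H \<and> adjacency H m')"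
      by (rule runs_spanner_program) (auto simp: m r input_state_def E)
    then obtain t m' H where run: "exec spanner_program (m, r) t (m', r)" "t \<le> spanner_time n"
      and g: "greedy w E (2 * k - 1) f E H" and out: "adjacency H m'"
      unfolding runs_def by blast
    have HE: "H \<subseteq> E" using g unfolding greedy_def by blast
    have H: "output_edges n (m', r) = H"
    proof (intro equalityI subsetI)
      fix e assume "e \<in> output_edges n (m', r)"
      then show "e \<in> H" using out by (auto simp: output_edges_def adjacency_def)
    next
      fix e assume e: "e \<in> H"
      then have "e \<in> E" using HE by blast
      then obtain a b where ab: "e = {a, b}" "a < b" using edge_ordered[OF E] by metis
      moreover have "b < n" using \<open>e \<in> E\<close> ab E by (auto simp: simple_graph_def)
      moreover have "0 < m' ''out'' [a, b]" using out e ab by (simp add: adjacency_def)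
      ultimately show "e \<in> output_edges n (m', r)" unfolding output_edges_def by auto
    qed
    have "n \<le> input_size f k n E" by (simp add: input_size_def)
    then have time: "t \<le> poly p (input_size f k n E)"
      using run(2) p poly_nat_mono[of n "input_size f k n E" p] by simp
    \<comment> \<open>With all edges processed, \<open>greedy_bypass\<close> is exactly the bypass
      hypothesis of \<open>eft_spannerI\<close>.\<close>
    have "eft_spanner f (real (2 * k - 1)) {..<n} E w H"
      using k by (intro eft_spannerI[OF E w HE _ greedy_bypass[OF g]]) simp_all
    moreover have "real (2 * k - 1) = 2 * real k - 1" using k by (simp add: of_nat_diff)
    ultimately have span: "eft_spanner f (2 * real k - 1) {..<n} E w (output_edges n (m', r))"
      unfolding H by simp
    obtain es where es: "set es = H" "blocked_order ((2 * k - 1) * f) (2 * k - 1) es"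
      using g unfolding greedy_def by blast
    have "simple_graph {..<n} (set es)" using es(1) HE E by (auto simp: simple_graph_def)
    from blocked_order_bound[OF es(2) this k f]
    have "real (card (output_edges n (m', r))) \<le>
            (if odd k
             then 128 * (real k powr (5/2) * real f powr (1/2 - 1 / (2 * real k))
                         * real n powr (1 + 1 / real k)
                       + real k ^ 2 * real f * real n)
             else 128 * (real k powr (5/2) * real f powr (1/2)
                         * real n powr (1 + 1 / real k)
                       + real k ^ 2 * real f * real n))"
      using half_div_odd[of k] half_div_even[of k] k unfolding H es(1) by (cases "odd k") simp_all
    then show ?case using run(1) time span unfolding mr by blast
  qed simp
qed

end
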